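(* Let $N\ge 3$ be an integer, $p>(N+2)/(N-2)$, $b>0$ and $\lambda>0$. Suppose the problem on a ball \[ u''+\frac{N-1}{r}u'+\lambda u+u^p=0,\ r\in(0,b),\qquad u'(0)=u(b)=0, \] has at least one positive solution. Then there exists $a_0\in(0,b)$ such that for every $a\in(0,a_0)$ the problem \[ u''+\frac{N-1}{r}u'+\lambda u+u^p=0,\ r\in(a,b),\qquad u(a)=u(b)=0, \] has at least three positive solutions.
   Context: A positive solution of the ball problem is a solution positive on $[0,b)$; a positive solution of the annulus problem is a solution positive on $(a,b)$. *)

theory Defs
  imports "HOL-Analysis.Analysis"
begin

definition ball_solution :: "nat \<Rightarrow> real \<Rightarrow> real \<Rightarrow> real \<Rightarrow> (real \<Rightarrow> real) \<Rightarrow> bool" where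
  "ball_solution N lam p b u \<longleftrightarrow>
     (\<exists>v w. (\<forall>r\<in>{0..b}. (u has_real_derivative v r) (at r within {0..b}))
          \<and> continuous_on {0..b} v
          \<and> (\<forall>r\<in>{0<..<b}. (v has_real_derivative w r) (at r))
          \<and> (\<forall>r\<in>{0<..<b}. w r + (real N - 1) / r * v r + lam * u r + u r powr p = 0)
          \<and> v 0 = 0 \<and> u b = 0)"

definition positive_ball_solution :: "nat \<Rightarrow> real \<Rightarrow> real \<Rightarrow> real \<Rightarrow> (real \<Rightarrow> real) \<Rightarrow> bool" where
  "positive_ball_solution N lam p b u \<longleftrightarrow>
     ball_solution N lam p b u \<and> (\<forall>r\<in>{0..<b}. u r > 0)"

definition annulus_solution :: "nat \<Rightarrow> real \<Rightarrow> real \<Rightarrow> real \<Rightarrow> real \<Rightarrow> (real \<Rightarrow> real) \<Rightarrow> bool" where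
  "annulus_solution N lam p a b u \<longleftrightarrow>
     (\<exists>v w. (\<forall>r\<in>{a..b}. (u has_real_derivative v r) (at r within {a..b}))
          \<and> continuous_on {a..b} v
          \<and> (\<forall>r\<in>{a<..<b}. (v has_real_derivative w r) (at r))
          \<and> (\<forall>r\<in>{a<..<b}. w r + (real N - 1) / r * v r + lam * u r + u r powr p = 0)
          \<and> u a = 0 \<and> u b = 0)"

definition positive_annulus_solution :: "nat \<Rightarrow> real \<Rightarrow> real \<Rightarrow> real \<Rightarrow> real \<Rightarrow> (real \<Rightarrow> real) \<Rightarrow> bool" where
  "positive_annulus_solution N lam p a b u \<longleftrightarrow>
     annulus_solution N lam p a b u \<and> (\<forall>r\<in>{a<..<b}. u r > 0)"

end

theory Submission
  imports Defs
begin

text \<open>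
  With \<open>r = b * exp (- t)\<close>, solutions vanishing at \<open>r = b\<close> become solutions \<open>u\<close> on \<open>[0, \<infinity>)\<close> with
  \<open>u 0 = 0\<close>, and one shoots in the slope \<open>s = u' 0\<close>. Because \<open>exp (- (N - 2) * t) * u' t\<close> is
  nonincreasing, \<open>u\<close> stays negative once it has reached zero, so the zeros of \<open>s \<mapsto> u T\<close> are exactly
  the positive solutions on the annulus with \<open>a = b * exp (- T)\<close>. For large \<open>T\<close> this function of \<open>s\<close>
  changes sign three times. It is positive at the slope \<open>s'\<close> of the given ball solution, positive for
  very small \<open>s\<close> (comparison with the ball solution) and negative for some \<open>s > s'\<close>, since solutions
  positive for all \<open>t > 0\<close> have bounded slope. It is also negative for some \<open>s < s'\<close>. Indeed, for
  small \<open>s\<close> the solution behaves like a multiple of the fundamental solution \<open>r powr (2 - N)\<close>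
  on a long initial interval, whereas in the supercritical range a Lyapunov functional of Pohozaev type
  forces every solution that is positive for all \<open>t > 0\<close> to grow strictly more slowly.
\<close>

section \<open>Initial value problems with Lipschitz right-hand side\<close>

primrec picard :: "'a::banach \<Rightarrow> (real \<Rightarrow> 'a \<Rightarrow> 'a) \<Rightarrow> nat \<Rightarrow> real \<Rightarrow> 'a" where
  "picard c F 0 = (\<lambda>_. c)"
| "picard c F (Suc n) = (\<lambda>t. c + integral {0..t} (\<lambda>s. F s (picard c F n s)))"

lemma continuous_on_along:
  fixes F :: "real \<Rightarrow> 'a::topological_space \<Rightarrow> 'b::topological_space"
  assumes "continuous_on ({0..} \<times> UNIV) (\<lambda>(t, x). F t x)" and "continuous_on {0..A} x"
  shows "continuous_on {0..A} (\<lambda>t. F t (x t))"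
proof -
  have "continuous_on {0..A} (\<lambda>t. (t, x t))"
    using assms(2) by (intro continuous_intros)
  moreover have "(\<lambda>t. (t, x t)) ` {0..A} \<subseteq> {0..} \<times> UNIV" by auto
  ultimately show ?thesis using continuous_on_compose2[OF assms(1)] by fastforce
qed

lemma continuous_on_picard:
  assumes "continuous_on ({0..} \<times> UNIV) (\<lambda>(t, x). F t x)"
  shows "continuous_on {0..A} (picard c F n)"
proof (induction n)
  case (Suc n)
  have "(\<lambda>s. F s (picard c F n s)) integrable_on {0..A}"
    by (rule integrable_continuous_real) (rule continuous_on_along[OF assms Suc])
  then show ?case
    by (auto intro!: continuous_intros indefinite_integral_continuous_1)
qed simp

text \<open>Integrating the Lipschitz estimate once per iteration produces the factorial. The
  increments are therefore summable on all of \<open>{0..A}\<close>, however large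
  \<open>L * A\<close> is, and no solutions have to be glued from short time intervals.\<close>

lemma picard_increment_bound:
  fixes c :: "'a::banach"
  assumes cont: "continuous_on ({0..} \<times> UNIV) (\<lambda>(t, x). F t x)"
    and lip: "\<And>t. t \<in> {0..A} \<Longrightarrow> L-lipschitz_on UNIV (F t)"
    and D: "\<And>t. t \<in> {0..A} \<Longrightarrow> norm (picard c F 1 t - picard c F 0 t) \<le> D"
    and t: "t \<in> {0..A}"
  shows "norm (picard c F (Suc n) t - picard c F n t) \<le> D * (L * t) ^ n / fact n"
  using t
proof (induction n arbitrary: t)
  case 0
  then show ?case using D[of t] by simp
next
  case (Suc n)
  note contF = continuous_on_along[OF cont continuous_on_picard[OF cont]]
  have L: "L \<ge> 0" using lip[OF Suc.prems] lipschitz_on_nonneg by blast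
  let ?G = "\<lambda>n s. F s (picard c F n s)"
  have int: "?G n integrable_on {0..t}" for n
    by (intro integrable_continuous_real contF)
  have "((\<lambda>s. D * (L * s) ^ Suc n / fact (Suc n)) has_real_derivative L * (D * (L * s) ^ n / fact n))
          (at s within {0..t})" for s
    by (auto intro!: derivative_eq_intros simp del: power_Suc)
  then have ftc: "((\<lambda>s. L * (D * (L * s) ^ n / fact n)) has_integral
               D * (L * t) ^ Suc n / fact (Suc n) - D * (L * 0) ^ Suc n / fact (Suc n)) {0..t}"
    using Suc.prems
    by (intro fundamental_theorem_of_calculus)
       (auto simp: has_real_derivative_iff_has_vector_derivative[symmetric] simp del: power_Suc)
  have "picard c F (Suc (Suc n)) t - picard c F (Suc n) t = integral {0..t} (\<lambda>s. ?G (Suc n) s - ?G n s)"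
    using Henstock_Kurzweil_Integration.integral_diff[OF int[of "Suc n"] int[of n]] by simp
  also have "norm \<dots> \<le> integral {0..t} (\<lambda>s. L * (D * (L * s) ^ n / fact n))"
  proof (rule integral_norm_bound_integral)
    show "(\<lambda>s. ?G (Suc n) s - ?G n s) integrable_on {0..t}"
      by (intro Henstock_Kurzweil_Integration.integrable_diff int)
    show "(\<lambda>s. L * (D * (L * s) ^ n / fact n)) integrable_on {0..t}"
      using ftc by blast
    fix s assume s: "s \<in> {0..t}"
    then have sA: "s \<in> {0..A}" using Suc.prems by auto
    have "norm (?G (Suc n) s - ?G n s) \<le> L * norm (picard c F (Suc n) s - picard c F n s)"
      using lipschitz_on_normD[OF lip[OF sA]] by blast
    also have "\<dots> \<le> L * (D * (L * s) ^ n / fact n)"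
      by (intro mult_left_mono Suc.IH sA L)
    finally show "norm (?G (Suc n) s - ?G n s) \<le> L * (D * (L * s) ^ n / fact n)" .
  qed
  also have "\<dots> = D * (L * t) ^ Suc n / fact (Suc n)"
    unfolding integral_unique[OF ftc] by simp
  finally show ?case .
qed

lemma picard_uniform_limit:
  fixes c :: "'a::banach"
  assumes cont: "continuous_on ({0..} \<times> UNIV) (\<lambda>(t, x). F t x)"
    and lip: "\<And>t. t \<in> {0..A} \<Longrightarrow> L-lipschitz_on UNIV (F t)"
  shows "uniform_limit {0..A} (picard c F) (\<lambda>t. c + (\<Sum>i. picard c F (Suc i) t - picard c F i t)) sequentially"
proof (cases "A \<ge> 0")
  case True
  then have L: "L \<ge> 0" using lip[of 0] lipschitz_on_nonneg by auto
  have "continuous_on {0..A} (\<lambda>t. picard c F 1 t - picard c F 0 t)"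
    by (intro continuous_intros continuous_on_picard cont)
  then have "bounded ((\<lambda>t. picard c F 1 t - picard c F 0 t) ` {0..A})"
    by (intro compact_imp_bounded compact_continuous_image) auto
  then obtain D where D: "\<And>t. t \<in> {0..A} \<Longrightarrow> norm (picard c F 1 t - picard c F 0 t) \<le> D"
    unfolding bounded_iff by blast
  have D0: "D \<ge> 0" using D[of 0] True norm_ge_zero order_trans by fastforce
  have "uniform_limit {0..A} (\<lambda>n t. \<Sum>i<n. picard c F (Suc i) t - picard c F i t)
          (\<lambda>t. \<Sum>i. picard c F (Suc i) t - picard c F i t) sequentially"
  proof (rule Weierstrass_m_test)
    show "summable (\<lambda>n. D * ((L * A) ^ n /\<^sub>R fact n))"
      by (intro summable_mult summable_exp_generic)
    fix n t assume t: "t \<in> {0..A}"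
    have "norm (picard c F (Suc n) t - picard c F n t) \<le> D * (L * t) ^ n / fact n"
      by (rule picard_increment_bound[OF cont lip D t])
    also have "\<dots> \<le> D * (L * A) ^ n / fact n"
      using t L D0 by (intro divide_right_mono mult_left_mono power_mono) auto
    finally show "norm (picard c F (Suc n) t - picard c F n t) \<le> D * ((L * A) ^ n /\<^sub>R fact n)"
      by (simp add: divide_inverse mult_ac)
  qed
  then have "uniform_limit {0..A} (\<lambda>n t. c + (\<Sum>i<n. picard c F (Suc i) t - picard c F i t))
          (\<lambda>t. c + (\<Sum>i. picard c F (Suc i) t - picard c F i t)) sequentially"
    by (intro uniform_limit_intros)
  moreover have "picard c F = (\<lambda>n t. c + (\<Sum>i<n. picard c F (Suc i) t - picard c F i t))"
    using sum_lessThan_telescope[of "\<lambda>i. picard c F i t" for t] by (intro ext) simp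
  ultimately show ?thesis by simp
qed simp

text \<open>The iterates converge uniformly on each \<open>{0..A}\<close>, with a Lipschitz constant
  that may depend on \<open>A\<close>. The integral equation thus passes to the limit on every
  bounded interval, and one function serves all times.\<close>

theorem picard_lindelof:
  fixes c :: "'a::banach"
  assumes cont: "continuous_on ({0..} \<times> UNIV) (\<lambda>(t, x). F t x)"
    and lip: "\<And>A. \<exists>L. \<forall>t\<in>{0..A}. L-lipschitz_on UNIV (F t)"
  obtains x where "x 0 = c" "\<And>t. t \<ge> 0 \<Longrightarrow> (x has_vector_derivative F t (x t)) (at t within {0..})"
proof -
  define x where "x \<equiv> \<lambda>t. c + (\<Sum>i. picard c F (Suc i) t - picard c F i t)"
  have lim: "uniform_limit {0..A} (picard c F) x sequentially" for A
    using picard_uniform_limit[OF cont] lip[of A] unfolding x_def by blast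
  have xcont: "continuous_on {0..A} x" for A
    by (rule uniform_limit_theorem[OF _ lim]) (auto intro!: always_eventually continuous_on_picard cont)
  have inteq: "x t = c + integral {0..t} (\<lambda>s. F s (x s))" if t: "t \<ge> 0" for t
  proof -
    obtain L where L: "\<And>s. s \<in> {0..t} \<Longrightarrow> L-lipschitz_on UNIV (F s)" using lip by blast
    have L0: "L \<ge> 0" using L[of 0] t lipschitz_on_nonneg by auto
    have "uniform_limit {0..t} (\<lambda>n s. F s (picard c F n s)) (\<lambda>s. F s (x s)) sequentially"
    proof (rule uniform_limitI)
      fix e :: real assume e: "e > 0"
      have "\<forall>\<^sub>F n in sequentially. \<forall>s\<in>{0..t}. dist (picard c F n s) (x s) < e / (L + 1)"
        using lim e L0 by (intro uniform_limitD) auto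
      then show "\<forall>\<^sub>F n in sequentially. \<forall>s\<in>{0..t}. dist (F s (picard c F n s)) (F s (x s)) < e"
      proof eventually_elim
        case (elim n)
        show ?case
        proof
          fix s assume s: "s \<in> {0..t}"
          have "dist (F s (picard c F n s)) (F s (x s)) \<le> L * dist (picard c F n s) (x s)"
            using lipschitz_onD[OF L[OF s]] by blast
          also have "\<dots> \<le> L * (e / (L + 1))"
            using elim s L0 by (intro mult_left_mono) (auto intro: less_imp_le)
          also have "\<dots> < e" using e L0 by (simp add: field_simps)
          finally show "dist (F s (picard c F n s)) (F s (x s)) < e" .
        qed
      qed
    qed
    then obtain I J where I: "\<And>n. ((\<lambda>s. F s (picard c F n s)) has_integral I n) {0..t}"
      and J: "((\<lambda>s. F s (x s)) has_integral J) {0..t}" and IJ: "I \<longlonglongrightarrow> J"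
      using continuous_on_along[OF cont continuous_on_picard[OF cont]]
      by (auto elim!: uniform_limit_integral)
    have "(\<lambda>n. picard c F n t) \<longlonglongrightarrow> x t"
      using lim[of t] t by (intro tendsto_uniform_limitI[where S="{0..t}"]) auto
    then have "(\<lambda>n. picard c F (Suc n) t) \<longlonglongrightarrow> x t" by (rule LIMSEQ_Suc)
    moreover have "(\<lambda>n. picard c F (Suc n) t) \<longlonglongrightarrow> c + J"
      using tendsto_add[OF tendsto_const IJ, of c] by (simp add: integral_unique[OF I])
    ultimately have "x t = c + J" by (rule LIMSEQ_unique)
    then show ?thesis using J by (simp add: integral_unique)
  qed
  show thesis
  proof
    show "x 0 = c" using inteq[of 0] by simp
    fix t :: real assume t: "t \<ge> 0"
    have "((\<lambda>r. integral {0..r} (\<lambda>s. F s (x s))) has_vector_derivative F t (x t)) (at t within {0..t+1})"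
      using t by (intro integral_has_vector_derivative continuous_on_along[OF cont xcont]) auto
    then have "((\<lambda>r. c + integral {0..r} (\<lambda>s. F s (x s))) has_vector_derivative F t (x t)) (at t within {0..t+1})"
      by (auto intro!: derivative_eq_intros)
    then have "(x has_vector_derivative F t (x t)) (at t within {0..t+1})"
      by (rule has_vector_derivative_transform[rotated 2]) (use t inteq[symmetric] in auto)
    moreover have "at t within {0..t+1} = at t within {0..}"
      by (rule at_within_nhd[of _ "{..<t+1}"]) auto
    ultimately show "(x has_vector_derivative F t (x t)) (at t within {0..})" by simp
  qed
qed

text \<open>Gronwall in differential form: the squared distance multiplied by
  \<open>exp (- 2 * L * t)\<close> is nonincreasing, by Cauchy-Schwarz and the Lipschitz
  bound.\<close>

lemma lipschitz_flow_diff_bound: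
  fixes x y :: "real \<Rightarrow> 'a::real_inner"
  assumes lip: "\<And>t. t \<in> {0..A} \<Longrightarrow> L-lipschitz_on UNIV (F t)" and A: "A \<ge> 0"
    and x: "\<And>t. 0 < t \<Longrightarrow> t < A \<Longrightarrow> (x has_vector_derivative F t (x t)) (at t)" "continuous_on {0..A} x"
    and y: "\<And>t. 0 < t \<Longrightarrow> t < A \<Longrightarrow> (y has_vector_derivative F t (y t)) (at t)" "continuous_on {0..A} y"
  shows "norm (x A - y A) \<le> norm (x 0 - y 0) * exp (L * A)"
proof -
  define d where "d \<equiv> \<lambda>t. x t - y t"
  define G where "G \<equiv> \<lambda>t. (d t \<bullet> d t) * exp (- 2 * L * t)"
  have "G A \<le> G 0"
  proof (rule DERIV_nonpos_imp_decreasing_open[OF A])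
    show "continuous_on {0..A} G"
      unfolding G_def d_def by (intro continuous_intros x y)
    fix t assume t: "0 < t" "t < A"
    let ?D = "F t (x t) - F t (y t)"
    have "(d has_vector_derivative ?D) (at t)"
      unfolding d_def by (intro has_vector_derivative_diff x y t)
    then have "((\<lambda>t. d t \<bullet> d t) has_real_derivative (2 * (d t \<bullet> ?D))) (at t)"
      unfolding has_field_derivative_def has_vector_derivative_def
      by (auto intro!: derivative_eq_intros simp: inner_commute algebra_simps)
    then have "(G has_real_derivative (2 * (d t \<bullet> ?D) - 2 * L * (d t \<bullet> d t)) * exp (- 2 * L * t)) (at t)"
      unfolding G_def by (auto intro!: derivative_eq_intros simp: algebra_simps)
    moreover have "d t \<bullet> ?D \<le> L * (d t \<bullet> d t)"
    proof -
      have "d t \<bullet> ?D \<le> norm (d t) * norm ?D" by (rule norm_cauchy_schwarz)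
      also have "\<dots> \<le> norm (d t) * (L * norm (d t))"
        using lipschitz_on_normD[OF lip, of t "x t" "y t"] t
        by (intro mult_left_mono) (auto simp: d_def)
      finally show ?thesis by (simp add: dot_square_norm power2_eq_square mult_ac)
    qed
    ultimately show "\<exists>D. (G has_real_derivative D) (at t) \<and> D \<le> 0"
      by (intro exI[of _ "(2 * (d t \<bullet> ?D) - 2 * L * (d t \<bullet> d t)) * exp (- 2 * L * t)"])
         (auto intro!: mult_nonpos_nonneg)
  qed
  then have "(norm (d A))\<^sup>2 * exp (- 2 * L * A) \<le> (norm (d 0))\<^sup>2"
    by (simp add: G_def dot_square_norm)
  then have "(norm (d A))\<^sup>2 \<le> (norm (d 0))\<^sup>2 * exp (2 * L * A)"
    by (simp add: exp_minus field_simps)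
  also have "\<dots> = (norm (d 0) * exp (L * A))\<^sup>2"
    by (simp add: power_mult_distrib exp_double[symmetric] mult_ac)
  finally show ?thesis
    unfolding d_def by (rule power2_le_imp_le) auto
qed

section \<open>Shooting\<close>

text \<open>The second-order equation is imposed for \<open>t > 0\<close> only. At
  \<open>t = 0\<close>, which corresponds to \<open>r = b\<close>, the radial problems provide just
  a one-sided derivative of \<open>u\<close> and continuity of the slope.\<close>

definition ode_sol :: "real \<Rightarrow> (real \<Rightarrow> real \<Rightarrow> real) \<Rightarrow> real \<Rightarrow> (real \<Rightarrow> real) \<Rightarrow> (real \<Rightarrow> real) \<Rightarrow> bool" where
  "ode_sol k f s u w \<longleftrightarrow>
     (\<forall>t\<ge>0. (u has_real_derivative w t) (at t within {0..})) \<and> continuous_on {0..} w \<and>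
     (\<forall>t>0. (w has_real_derivative k * w t - f t (u t)) (at t)) \<and> u 0 = 0 \<and> w 0 = s"

lemma ode_solD:
  assumes "ode_sol k f s u w"
  shows "t > 0 \<Longrightarrow> (u has_real_derivative w t) (at t)"
    and "t > 0 \<Longrightarrow> (w has_real_derivative k * w t - f t (u t)) (at t)"
    and "a \<ge> 0 \<Longrightarrow> continuous_on {a..b} u"
    and "a \<ge> 0 \<Longrightarrow> continuous_on {a..b} w"
    and "u 0 = 0" and "w 0 = s"
proof -
  have u: "(u has_real_derivative w t) (at t within {0..})" if "t \<ge> 0" for t
    using assms that unfolding ode_sol_def by auto
  have "continuous_on {0..} u"
    using u by (intro DERIV_continuous_on) auto
  then show "a \<ge> 0 \<Longrightarrow> continuous_on {a..b} u" by (rule continuous_on_subset) auto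
  show "a \<ge> 0 \<Longrightarrow> continuous_on {a..b} w"
    using assms unfolding ode_sol_def by (auto elim: continuous_on_subset)
  show "t > 0 \<Longrightarrow> (u has_real_derivative w t) (at t)"
    using u[of t] at_within_interior[of t "{0..}"] by (simp add: interior_real_atLeast)
qed (use assms in \<open>auto simp: ode_sol_def\<close>)

lemma ode_sol_cong:
  assumes "ode_sol k f s u w" and "\<And>t. t > 0 \<Longrightarrow> f t (u t) = g t (u t)"
  shows "ode_sol k g s u w"
  using assms unfolding ode_sol_def by auto

text \<open>The integrating factor \<open>exp (- k * t)\<close> removes the linear term and leaves
  the derivative \<open>- exp (- k * x) * f x (u x)\<close>.\<close>

lemma ode_sol_damped_antimono:
  assumes sol: "ode_sol k f s u w" and f: "\<And>t x. f t x \<ge> 0" and t: "0 \<le> t" "t \<le> t'"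
  shows "exp (- k * t') * w t' \<le> exp (- k * t) * w t"
proof (rule DERIV_nonpos_imp_decreasing_open[OF t(2)])
  show "continuous_on {t..t'} (\<lambda>t. exp (- k * t) * w t)"
    using t by (intro continuous_intros ode_solD(4)[OF sol])
  fix x assume x: "t < x" "x < t'"
  have "((\<lambda>t. exp (- k * t) * w t) has_real_derivative - exp (- k * x) * f x (u x)) (at x)"
    using x t by (auto intro!: derivative_eq_intros ode_solD(2)[OF sol] simp: algebra_simps)
  moreover have "- exp (- k * x) * f x (u x) \<le> 0" using f[of x] by simp
  ultimately show "\<exists>y. ((\<lambda>t. exp (- k * t) * w t) has_real_derivative y) (at x) \<and> y \<le> 0" by blast
qed

text \<open>A nonnegative source only lowers the damped slope, which starts at \<open>s\<close>. The
  resulting bound does not involve \<open>f\<close>, so it serves the clamped and the original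
  equation alike.\<close>

lemma ode_sol_growth:
  assumes sol: "ode_sol k f s u w" and f: "\<And>t x. f t x \<ge> 0" and k: "k \<ge> 0" and s: "s \<ge> 0" and t: "t \<ge> 0"
  shows "u t \<le> s * t * exp (k * t)"
proof -
  have w: "w x \<le> s * exp (k * t)" if "0 \<le> x" "x \<le> t" for x
  proof -
    have "w x \<le> s * exp (k * x)"
      using ode_sol_damped_antimono[OF sol f order_refl that(1)] ode_solD(6)[OF sol]
      by (simp add: exp_minus field_simps)
    also have "\<dots> \<le> s * exp (k * t)" using s k that by (intro mult_left_mono) (auto intro: mult_left_mono)
    finally show ?thesis .
  qed
  have "u t - s * exp (k * t) * t \<le> u 0 - s * exp (k * t) * 0"
  proof (rule DERIV_nonpos_imp_decreasing_open[OF t])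
    show "continuous_on {0..t} (\<lambda>x. u x - s * exp (k * t) * x)"
      by (intro continuous_intros ode_solD(3)[OF sol]) auto
    fix x assume x: "0 < x" "x < t"
    have "((\<lambda>x. u x - s * exp (k * t) * x) has_real_derivative w x - s * exp (k * t)) (at x)"
      using x by (auto intro!: derivative_eq_intros ode_solD(1)[OF sol])
    with w[of x] x show "\<exists>y. ((\<lambda>x. u x - s * exp (k * t) * x) has_real_derivative y) (at x) \<and> y \<le> 0"
      by force
  qed
  with ode_solD(5)[OF sol] show ?thesis by (simp add: mult_ac)
qed

lemma ode_sol_positive_initially:
  assumes sol: "ode_sol k f s u w" and s: "s > 0"
  shows "\<exists>d>0. \<forall>t. 0 < t \<and> t \<le> d \<longrightarrow> s / 2 * t < u t"
proof -
  have "continuous_on {0..1} w" by (rule ode_solD(4)[OF sol]) simp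
  then obtain d where d: "d > 0" "\<And>t. t \<in> {0..1} \<Longrightarrow> dist t 0 < d \<Longrightarrow> dist (w t) (w 0) < s / 2"
    using s unfolding continuous_on_iff by (metis atLeastAtMost_iff half_gt_zero order_refl zero_le_one)
  define e where "e = min (d / 2) 1"
  have e: "e > 0" "e \<le> 1" "e < d" using d by (auto simp: e_def)
  have "s / 2 * t < u t" if t: "0 < t" "t \<le> e" for t
  proof -
    have "u 0 - s / 2 * 0 < u t - s / 2 * t"
    proof (rule DERIV_pos_imp_increasing_open[OF t(1)])
      show "continuous_on {0..t} (\<lambda>x. u x - s / 2 * x)"
        by (intro continuous_intros ode_solD(3)[OF sol]) auto
      fix x assume x: "0 < x" "x < t"
      have "((\<lambda>x. u x - s / 2 * x) has_real_derivative w x - s / 2) (at x)"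
        using x by (auto intro!: derivative_eq_intros ode_solD(1)[OF sol])
      moreover have "w x - s / 2 > 0"
        using d(2)[of x] x t e ode_solD(6)[OF sol] by (auto simp: dist_real_def abs_if split: if_splits)
      ultimately show "\<exists>y. ((\<lambda>x. u x - s / 2 * x) has_real_derivative y) (at x) \<and> 0 < y" by blast
    qed
    with ode_solD(5)[OF sol] show ?thesis by simp
  qed
  with e(1) show ?thesis by blast
qed

text \<open>Descending from a positive value to \<open>u c \<le> 0\<close> forces a negative slope
  somewhere before \<open>c\<close>, and monotonicity of the damped slope keeps \<open>w\<close>
  negative from there on. Consequently a zero at \<open>T\<close> implies positivity on the whole of
  \<open>(0, T)\<close>.\<close>

lemma ode_sol_negative_after_zero:
  assumes sol: "ode_sol k f s u w" and f: "\<And>t x. f t x \<ge> 0" and s: "s > 0"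
    and c: "c > 0" "u c \<le> 0" and T: "c < T"
  shows "u T < 0"
proof -
  obtain d where d: "d > 0" "\<And>t. 0 < t \<Longrightarrow> t \<le> d \<Longrightarrow> s / 2 * t < u t"
    using ode_sol_positive_initially[OF sol s] by blast
  define e where "e = min d (c / 2)"
  have e: "e > 0" "e < c" "e \<le> d" using d(1) c by (auto simp: e_def)
  have ue: "u e > 0"
    using d(2)[OF e(1,3)] mult_pos_pos[of "s / 2" e] s e(1) by linarith
  obtain x where x: "e < x" "x < c" "w x < 0"
  proof -
    have "\<exists>l x. e < x \<and> x < c \<and> (u has_real_derivative l) (at x) \<and> u c - u e = (c - e) * l"
    proof (intro MVT ode_solD(3)[OF sol])
      show "u differentiable (at x)" if "e < x" for x
        using ode_solD(1)[OF sol, of x] that e real_differentiable_def by fastforce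
    qed (use e in auto)
    then obtain l x where lx: "e < x" "x < c" "(u has_real_derivative l) (at x)" "u c - u e = (c - e) * l" by blast
    have "l = w x" using lx(1,3) e ode_solD(1)[OF sol, of x] DERIV_unique by fastforce
    moreover have "(c - e) * l < 0" using lx(4) ue c by auto
    ultimately have "w x < 0" using e by (simp add: mult_less_0_iff)
    with lx that show thesis by blast
  qed
  have w: "w t < 0" if "t \<ge> x" for t
  proof -
    have "exp (- k * t) * w t < 0"
      using ode_sol_damped_antimono[OF sol f, of x t] that x e
      by (smt (verit) exp_gt_zero mult_pos_neg)
    then show ?thesis by (simp add: mult_less_0_iff)
  qed
  have "u c > u T"
  proof (rule DERIV_neg_imp_decreasing_open[OF T])
    show "continuous_on {c..T} u" using c by (intro ode_solD(3)[OF sol]) auto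
    show "\<exists>y. (u has_real_derivative y) (at t) \<and> y < 0" if "c < t" "t < T" for t
      using that c x w[of t] ode_solD(1)[OF sol, of t] by (intro exI[of _ "w t"]) auto
  qed
  with c show ?thesis by simp
qed

section \<open>The clamped equation and continuous dependence on the slope\<close>

lemma powr_clamped_lipschitz:
  fixes a b p M :: real
  assumes p: "p > 1" and a: "0 \<le> a" "a \<le> M" and b: "0 \<le> b" "b \<le> M"
  shows "\<bar>a powr p - b powr p\<bar> \<le> p * M powr (p - 1) * \<bar>a - b\<bar>"
proof -
  have main: "y powr p - x powr p \<le> p * M powr (p - 1) * (y - x)" if xy: "0 \<le> x" "x < y" "y \<le> M" for x y
  proof -
    have d: "((\<lambda>z. z powr p) has_real_derivative p * z powr (p - 1)) (at z)" if "x < z" for z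
      using that xy by (auto intro!: derivative_eq_intros)
    have "\<exists>l z. x < z \<and> z < y \<and> ((\<lambda>z. z powr p) has_real_derivative l) (at z) \<and> y powr p - x powr p = (y - x) * l"
      using xy p d by (intro MVT continuous_on_powr') (auto intro!: continuous_intros simp: real_differentiable_def)
    then obtain l z where z: "x < z" "z < y" "((\<lambda>z. z powr p) has_real_derivative l) (at z)"
      "y powr p - x powr p = (y - x) * l" by blast
    have "l = p * z powr (p - 1)" using d[OF z(1)] z(3) DERIV_unique by blast
    also have "\<dots> \<le> p * M powr (p - 1)" using p z xy by (intro mult_left_mono powr_mono2) auto
    finally have "(y - x) * l \<le> (y - x) * (p * M powr (p - 1))" using xy by (intro mult_left_mono) auto
    with z show ?thesis by (simp add: mult_ac)
  qed
  have mono: "x powr p \<le> y powr p" if "0 \<le> x" "x \<le> y" for x y :: real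
    using that p by (intro powr_mono2) auto
  consider "a = b" | "a < b" | "b < a" by linarith
  then show ?thesis
    using main[of a b] main[of b a] mono[of a b] mono[of b a] a b by cases auto
qed

locale emden =
  fixes k B lam p :: real
  assumes k: "k > 0" and B: "B > 0" and lam: "lam > 0" and p: "p > 1"
begin

text \<open>Taking positive parts leaves the equation unchanged where \<open>u\<close> is positive
  and switches the source off elsewhere. Solutions can thus be continued past a zero while the
  source stays nonnegative, as the damped slope argument requires.\<close>

definition rhs :: "real \<Rightarrow> real \<Rightarrow> real" where
  "rhs t x = B * exp (- 2 * t) * (lam * max x 0 + max x 0 powr p)"

text \<open>Clamping the power at the a priori bound of \<open>ode_sol_growth\<close> makes the equation globally
  Lipschitz on bounded time intervals without affecting solutions of slope at most \<open>S\<close>.\<close>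

definition clamped_rhs :: "real \<Rightarrow> real \<Rightarrow> real \<Rightarrow> real" where
  "clamped_rhs S t x = B * exp (- 2 * t) * (lam * max x 0 + min (max x 0) (S * max t 0 * exp (k * t)) powr p)"

abbreviation "sol \<equiv> ode_sol k rhs"

lemma rhs_nonneg: "rhs t x \<ge> 0"
  unfolding rhs_def using B lam by auto

lemma clamped_rhs_nonneg: "clamped_rhs S t x \<ge> 0"
  unfolding clamped_rhs_def using B lam by auto

lemma clamped_rhs_eq_rhs:
  assumes "x \<le> S * t * exp (k * t)" "S \<ge> 0" "t \<ge> 0"
  shows "clamped_rhs S t x = rhs t x"
proof -
  have "S * max t 0 * exp (k * t) \<ge> 0" using assms by (intro mult_nonneg_nonneg) auto
  then have "min (max x 0) (S * max t 0 * exp (k * t)) = max x 0" using assms by auto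
  then show ?thesis unfolding clamped_rhs_def rhs_def by simp
qed

text \<open>Both sources are nonnegative, so \<open>ode_sol_growth\<close> applies to either
  equation and keeps the solution below the clamp, where the two right-hand sides agree.\<close>

lemma sol_iff_clamped:
  assumes "0 \<le> s" "s \<le> S"
  shows "ode_sol k (clamped_rhs S) s u w \<longleftrightarrow> sol s u w"
proof -
  have le: "x \<le> S * t * exp (k * t)" if "x \<le> s * t * exp (k * t)" "t > 0" for x t
    using that assms by (elim order_trans) (intro mult_right_mono, auto)
  show ?thesis
  proof
    assume sol: "ode_sol k (clamped_rhs S) s u w"
    then show "sol s u w"
      using ode_sol_growth[OF sol clamped_rhs_nonneg] k assms le
      by (elim ode_sol_cong) (rule clamped_rhs_eq_rhs, auto intro: le)
  next
    assume sol: "sol s u w"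
    then show "ode_sol k (clamped_rhs S) s u w"
      using ode_sol_growth[OF sol rhs_nonneg] k assms le
      by (elim ode_sol_cong) (rule clamped_rhs_eq_rhs[symmetric], auto intro: le)
  qed
qed

definition field :: "real \<Rightarrow> real \<Rightarrow> real \<times> real \<Rightarrow> real \<times> real" where
  "field S t X = (snd X, k * snd X - clamped_rhs S t (fst X))"

lemma continuous_on_field:
  assumes "S \<ge> 0"
  shows "continuous_on ({0..} \<times> UNIV) (\<lambda>(t, X). field S t X)"
proof -
  define c where "c \<equiv> \<lambda>z :: real \<times> real \<times> real. min (max (fst (snd z)) 0) (S * max (fst z) 0 * exp (k * fst z))"
  have "continuous_on ({0..} \<times> UNIV) c" unfolding c_def by (intro continuous_intros)
  moreover have "c z \<ge> 0" for z using assms by (auto simp: c_def)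
  ultimately have "continuous_on ({0..} \<times> UNIV) (\<lambda>z. c z powr p)"
    using p by (intro continuous_on_powr') auto
  then have "continuous_on ({0..} \<times> UNIV) (\<lambda>z. lam * max (fst (snd z)) 0 + c z powr p)"
    by (rule continuous_on_add[rotated]) (intro continuous_intros)
  then have "continuous_on ({0..} \<times> UNIV)
      (\<lambda>z. k * snd (snd z) - B * exp (- 2 * fst z) * (lam * max (fst (snd z)) 0 + c z powr p))"
    by (intro continuous_on_diff continuous_on_mult) (auto intro!: continuous_intros)
  then show ?thesis
    unfolding field_def clamped_rhs_def case_prod_beta c_def by (intro continuous_on_Pair) (auto intro!: continuous_intros)
qed

text \<open>For \<open>t \<le> A\<close> the clamp is at most \<open>M\<close>, so only powers of
  numbers in \<open>[0, M]\<close> occur, and these have slope at most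
  \<open>p * M powr (p - 1)\<close>.\<close>

lemma field_lipschitz:
  assumes S: "S \<ge> 0"
  shows "\<exists>L. \<forall>t\<in>{0..A}. L-lipschitz_on UNIV (field S t)"
proof (cases "A \<ge> 0")
  case A: True
  define M where "M = S * A * exp (k * A)"
  define C where "C = B * (lam + p * M powr (p - 1))"
  have C: "C \<ge> 0" using B lam p unfolding C_def by auto
  have clamped_rhs: "\<bar>clamped_rhs S t x - clamped_rhs S t y\<bar> \<le> C * \<bar>x - y\<bar>" if t: "t \<in> {0..A}" for t x y
  proof -
    define m where "m = S * max t 0 * exp (k * t)"
    have m: "0 \<le> m" "m \<le> M"
      using S t k unfolding m_def M_def by (auto intro!: mult_mono mult_nonneg_nonneg)
    define x' y' where "x' = min (max x 0) m" and "y' = min (max y 0) m"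
    have "\<bar>x' powr p - y' powr p\<bar> \<le> p * M powr (p - 1) * \<bar>x' - y'\<bar>"
      using m by (intro powr_clamped_lipschitz p) (auto simp: x'_def y'_def)
    also have "\<dots> \<le> p * M powr (p - 1) * \<bar>x - y\<bar>"
      using p m by (intro mult_left_mono) (auto simp: x'_def y'_def)
    finally have 1: "\<bar>x' powr p - y' powr p\<bar> \<le> p * M powr (p - 1) * \<bar>x - y\<bar>" .
    have 2: "\<bar>lam * max x 0 - lam * max y 0\<bar> \<le> lam * \<bar>x - y\<bar>"
      using lam by (simp add: right_diff_distrib[symmetric] abs_mult)
    have "clamped_rhs S t x - clamped_rhs S t y =
        B * exp (- 2 * t) * ((lam * max x 0 - lam * max y 0) + (x' powr p - y' powr p))"
      unfolding clamped_rhs_def x'_def y'_def m_def by (simp add: algebra_simps)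
    then have "\<bar>clamped_rhs S t x - clamped_rhs S t y\<bar> =
        B * exp (- 2 * t) * \<bar>(lam * max x 0 - lam * max y 0) + (x' powr p - y' powr p)\<bar>"
      using B by (simp add: abs_mult)
    also have "\<dots> \<le> B * 1 * (lam * \<bar>x - y\<bar> + p * M powr (p - 1) * \<bar>x - y\<bar>)"
      using 1 2 B t by (intro mult_mono order_trans[OF abs_triangle_ineq] add_mono) auto
    finally show ?thesis by (simp add: C_def algebra_simps)
  qed
  have "(1 + k + C)-lipschitz_on UNIV (field S t)" if t: "t \<in> {0..A}" for t
  proof (rule lipschitz_onI)
    fix X Y :: "real \<times> real"
    have X: "\<bar>fst X - fst Y\<bar> \<le> dist X Y" "\<bar>snd X - snd Y\<bar> \<le> dist X Y"
      using dist_fst_le[of X Y] dist_snd_le[of X Y] by (auto simp: dist_real_def)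
    have "dist (field S t X) (field S t Y) \<le>
        \<bar>snd X - snd Y\<bar> + \<bar>(k * snd X - clamped_rhs S t (fst X)) - (k * snd Y - clamped_rhs S t (fst Y))\<bar>"
      unfolding field_def dist_prod_def dist_real_def by (simp add: sqrt_sum_squares_le_sum_abs)
    also have "\<dots> \<le> \<bar>snd X - snd Y\<bar> + (k * \<bar>snd X - snd Y\<bar> + C * \<bar>fst X - fst Y\<bar>)"
    proof -
      have "\<bar>k * snd X - k * snd Y\<bar> = k * \<bar>snd X - snd Y\<bar>"
        using k by (simp add: right_diff_distrib[symmetric] abs_mult)
      with clamped_rhs[OF t, of "fst X" "fst Y"] show ?thesis by linarith
    qed
    also have "\<dots> \<le> dist X Y + (k * dist X Y + C * dist X Y)"
      using k C X by (intro add_mono mult_left_mono) auto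
    finally show "dist (field S t X) (field S t Y) \<le> (1 + k + C) * dist X Y"
      by (simp add: algebra_simps)
  qed (use k C in auto)
  then show ?thesis by blast
qed auto

lemma sol_exists:
  assumes s: "s \<ge> 0"
  shows "\<exists>u w. sol s u w"
proof -
  obtain X where X: "X 0 = (0, s)"
    "\<And>t. t \<ge> 0 \<Longrightarrow> (X has_vector_derivative field s t (X t)) (at t within {0..})"
    using picard_lindelof[OF continuous_on_field[OF s] field_lipschitz[OF s]] by blast
  have "((\<lambda>t. fst (X t)) has_vector_derivative fst (field s t (X t))) (at t within {0..})"
    "((\<lambda>t. snd (X t)) has_vector_derivative snd (field s t (X t))) (at t within {0..})" if "t \<ge> 0" for t
    using bounded_linear.has_vector_derivative[OF bounded_linear_fst X(2)[OF that]]
      bounded_linear.has_vector_derivative[OF bounded_linear_snd X(2)[OF that]] by auto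
  then have D: "((\<lambda>t. fst (X t)) has_real_derivative snd (X t)) (at t within {0..})"
    "((\<lambda>t. snd (X t)) has_real_derivative k * snd (X t) - clamped_rhs s t (fst (X t))) (at t within {0..})" if "t \<ge> 0" for t
    using that by (auto simp: has_real_derivative_iff_has_vector_derivative field_def)
  have "((\<lambda>t. snd (X t)) has_real_derivative k * snd (X t) - clamped_rhs s t (fst (X t))) (at t)" if "t > 0" for t
    using D(2)[of t] that at_within_interior[of t "{0..}"] by (simp add: interior_real_atLeast)
  moreover have "continuous_on {0..} (\<lambda>t. snd (X t))"
    using D(2) by (intro DERIV_continuous_on) auto
  ultimately have "ode_sol k (clamped_rhs s) s (\<lambda>t. fst (X t)) (\<lambda>t. snd (X t))"
    unfolding ode_sol_def using D X(1) by auto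
  then show ?thesis using sol_iff_clamped[of s s] s by auto
qed

text \<open>All slopes in \<open>{0..S}\<close> share the one equation clamped at \<open>S\<close>,
  hence a single constant \<open>C\<close>. The case \<open>s = s'\<close> contains
  uniqueness.\<close>

lemma sol_dependence:
  assumes "S \<ge> 0" "T \<ge> 0"
  shows "\<exists>C. \<forall>s s' u w u' w'. s \<in> {0..S} \<longrightarrow> s' \<in> {0..S} \<longrightarrow> sol s u w \<longrightarrow> sol s' u' w' \<longrightarrow>
           \<bar>u T - u' T\<bar> \<le> C * \<bar>s - s'\<bar>"
proof -
  obtain L where L: "\<And>t. t \<in> {0..T} \<Longrightarrow> L-lipschitz_on UNIV (field S t)"
    using field_lipschitz[OF assms(1)] by blast
  have D: "(\<And>t. 0 < t \<Longrightarrow> t < T \<Longrightarrow> ((\<lambda>t. (u t, w t)) has_vector_derivative field S t (u t, w t)) (at t))"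
    "continuous_on {0..T} (\<lambda>t. (u t, w t))" if "sol s u w" "s \<in> {0..S}" for s u w
  proof -
    have s: "ode_sol k (clamped_rhs S) s u w" using that sol_iff_clamped[of s S] by auto
    show "continuous_on {0..T} (\<lambda>t. (u t, w t))"
      by (intro continuous_intros ode_solD(3,4)[OF s]) auto
    show "((\<lambda>t. (u t, w t)) has_vector_derivative field S t (u t, w t)) (at t)" if "0 < t" for t
      using ode_solD(1,2)[OF s that] unfolding field_def
      by (auto simp: has_real_derivative_iff_has_vector_derivative intro!: has_vector_derivative_Pair)
  qed
  have "\<bar>u T - u' T\<bar> \<le> exp (L * T) * \<bar>s - s'\<bar>"
    if "s \<in> {0..S}" "s' \<in> {0..S}" and u: "sol s u w" and u': "sol s' u' w'" for s s' u w u' w'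
  proof -
    have "\<bar>u T - u' T\<bar> \<le> norm ((u T, w T) - (u' T, w' T))"
      using norm_fst_le[of "u T - u' T" "w T - w' T"] by simp
    also have "\<dots> \<le> norm ((u 0, w 0) - (u' 0, w' 0)) * exp (L * T)"
      by (rule lipschitz_flow_diff_bound[OF L assms(2)]) (use D that in auto)
    also have "norm ((u 0, w 0) - (u' 0, w' 0)) = \<bar>s - s'\<bar>"
      using ode_solD(5,6)[OF u] ode_solD(5,6)[OF u'] by (simp add: norm_Pair)
    finally show ?thesis by (simp add: mult_ac)
  qed
  then show ?thesis by blast
qed

lemma sol_intermediate_zero:
  assumes T: "T \<ge> 0" and s: "0 \<le> s1" "s1 < s2"
    and sol1: "sol s1 u1 w1" and sol2: "sol s2 u2 w2" and sign: "u1 T * u2 T < 0"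
  shows "\<exists>s u w. s1 < s \<and> s < s2 \<and> sol s u w \<and> u T = 0"
proof -
  obtain U W where U: "\<And>s. s \<ge> 0 \<Longrightarrow> sol s (U s) (W s)" using sol_exists by metis
  obtain C where C: "\<And>s s' u w u' w'. s \<in> {0..s2} \<Longrightarrow> s' \<in> {0..s2} \<Longrightarrow> sol s u w \<Longrightarrow> sol s' u' w' \<Longrightarrow>
       \<bar>u T - u' T\<bar> \<le> C * \<bar>s - s'\<bar>"
  proof -
    have "s2 \<ge> 0" using s by simp
    from sol_dependence[OF this T] that show thesis by blast
  qed
  have "C-lipschitz_on {s1..s2} (\<lambda>s. U s T)"
  proof (rule lipschitz_onI)
    show "C \<ge> 0" using C[OF _ _ sol1 sol2] s by (smt (verit) atLeastAtMost_iff mult_neg_pos)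
    show "dist (U x T) (U y T) \<le> C * dist x y" if "x \<in> {s1..s2}" "y \<in> {s1..s2}" for x y
      using C[of x y, OF _ _ U U] that s by (auto simp: dist_real_def)
  qed
  then have cont: "continuous_on {s1..s2} (\<lambda>s. U s T)" by (rule lipschitz_on_continuous_on)
  \<comment> \<open>Equal slopes make the Lipschitz bound zero, so the chosen family agrees at
    \<open>T\<close> with the two given solutions.\<close>
  have eq: "U s1 T = u1 T" "U s2 T = u2 T"
    using C[OF _ _ U sol1, of s1] C[OF _ _ U sol2, of s2] s by auto
  have "\<exists>x. s1 \<le> x \<and> x \<le> s2 \<and> U x T = 0"
  proof (cases "u1 T < 0")
    case True
    then show ?thesis using IVT'[of "\<lambda>s. U s T" s1 0 s2] sign s cont eq by (auto simp: mult_less_0_iff)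
  next
    case False
    then show ?thesis using IVT2'[of "\<lambda>s. U s T" s2 0 s1] sign s cont eq by (auto simp: mult_less_0_iff)
  qed
  then obtain x where x: "s1 \<le> x" "x \<le> s2" "U x T = 0" by blast
  moreover have "x \<noteq> s1" "x \<noteq> s2" using x eq sign by auto
  ultimately show ?thesis using U[of x] s by (intro exI[of _ x] exI[of _ "U x"] exI[of _ "W x"]) auto
qed

end

section \<open>Solutions without zeros\<close>

text \<open>Replaces integration up to infinity: it is applied with \<open>x = G t\<close> for a
  nonincreasing \<open>G\<close> whose later values are bounded below by a multiple of a decaying
  exponential.\<close>

lemma nonneg_if_ge_decay:
  fixes x :: real
  assumes a: "a > 0" and le: "\<And>\<tau>. \<tau> \<ge> t \<Longrightarrow> - c * exp (- a * \<tau>) \<le> x"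
  shows "0 \<le> x"
proof -
  have "filterlim (\<lambda>\<tau>. - a * \<tau>) at_bot at_top"
    using a by (intro filterlim_tendsto_neg_mult_at_bot[OF tendsto_const] filterlim_ident) auto
  then have "((\<lambda>\<tau>. - c * exp (- a * \<tau>)) \<longlongrightarrow> - c * 0) at_top"
    by (intro tendsto_mult tendsto_const filterlim_compose[OF exp_at_bot])
  moreover have "\<forall>\<^sub>F \<tau> in at_top. - c * exp (- a * \<tau>) \<le> x"
    using le by (auto simp: eventually_at_top_linorder)
  ultimately have "- c * 0 \<le> x" by (rule tendsto_upperbound) simp
  then show ?thesis by simp
qed

context emden
begin

text \<open>Both the regular solutions on the ball and those singular at \<open>r = 0\<close> are ground solutions.\<close>

definition ground :: "real \<Rightarrow> (real \<Rightarrow> real) \<Rightarrow> (real \<Rightarrow> real) \<Rightarrow> bool" where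
  "ground s u w \<longleftrightarrow> sol s u w \<and> s > 0 \<and> (\<forall>t>0. u t > 0)"

lemma groundD:
  assumes "ground s u w"
  shows "sol s u w" "s > 0" "t > 0 \<Longrightarrow> u t > 0"
  using assms unfolding ground_def by auto

lemma rhs_pos_eq: "x > 0 \<Longrightarrow> rhs t x = B * exp (- 2 * t) * (lam * x + x powr p)"
  unfolding rhs_def by simp

text \<open>A negative slope never recovers, since undoing the damping multiplies it by
  \<open>exp (k * (x - t)) \<ge> 1\<close>. The graph then lies below a falling line and crosses
  zero in finite time.\<close>

lemma ground_deriv_nonneg:
  assumes g: "ground s u w" and t: "t \<ge> 0"
  shows "w t \<ge> 0"
proof (rule ccontr)
  note sol = groundD(1)[OF g]
  assume "\<not> w t \<ge> 0"
  then have neg: "w t < 0" by simp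
  have w: "w x \<le> w t" if "x \<ge> t" for x
  proof -
    have "exp (- k * x) * w x \<le> exp (- k * t) * w t"
      using that by (intro ode_sol_damped_antimono[OF sol rhs_nonneg t])
    then have "w x \<le> exp (k * (x - t)) * w t"
      by (simp add: exp_minus exp_diff field_simps)
    also have "\<dots> \<le> 1 * w t"
      using neg k that by (intro mult_right_mono_neg) auto
    finally show ?thesis by simp
  qed
  \<comment> \<open>By time \<open>T\<close> the line of slope \<open>w t\<close> through
    \<open>(t, u t)\<close> has dropped by \<open>\<bar>u t\<bar> + 1\<close>.\<close>
  define T where "T = t + (\<bar>u t\<bar> + 1) / (- w t)"
  have T: "t < T" using neg by (simp add: T_def divide_simps)
  have "u T - w t * T \<le> u t - w t * t"
  proof (rule DERIV_nonpos_imp_decreasing_open[of t T "\<lambda>x. u x - w t * x"])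
    show "continuous_on {t..T} (\<lambda>x. u x - w t * x)"
      by (intro continuous_intros ode_solD(3)[OF sol t])
    fix x assume x: "t < x" "x < T"
    have "((\<lambda>x. u x - w t * x) has_real_derivative w x - w t) (at x)"
      using x t by (auto intro!: derivative_eq_intros ode_solD(1)[OF sol])
    then show "\<exists>y. ((\<lambda>x. u x - w t * x) has_real_derivative y) (at x) \<and> y \<le> 0"
      using w[of x] x by (intro exI[of _ "w x - w t"]) auto
  qed (use T in simp)
  also have "u t - w t * t = u t - w t * T - (\<bar>u t\<bar> + 1)"
    using neg by (simp add: T_def field_simps)
  finally have "u T < 0" by linarith
  moreover have "u T > 0" using groundD(3)[OF g, of T] T t by simp
  ultimately show False by simp
qed

lemma ground_mono:
  assumes g: "ground s u w" and t: "0 \<le> t" "t \<le> t'"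
  shows "u t \<le> u t'"
proof (rule DERIV_nonneg_imp_increasing_open[OF t(2)])
  show "continuous_on {t..t'} u" by (intro ode_solD(3)[OF groundD(1)[OF g] t(1)])
  show "\<exists>y. (u has_real_derivative y) (at x) \<and> 0 \<le> y" if "t < x" "x < t'" for x
    using that t ode_solD(1)[OF groundD(1)[OF g], of x] ground_deriv_nonneg[OF g, of x] by auto
qed

text \<open>The damped slope stays nonnegative, so it is at least the integral of its rate of
  decrease from \<open>t\<close> to infinity. Discarding the \<open>lam\<close> term and replacing
  \<open>u z\<close> by the smaller \<open>u t\<close> makes that integral explicit.\<close>

lemma ground_deriv_lower:
  assumes g: "ground s u w" and t: "t > 0"
  shows "B * u t powr p * exp (- 2 * t) / (k + 2) \<le> w t"
proof -
  note sol = groundD(1)[OF g]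
  define c where "c = B * u t powr p / (k + 2)"
  have c: "(k + 2) * c = B * u t powr p" using k by (simp add: c_def)
  define G where "G \<equiv> \<lambda>x. exp (- k * x) * w x - c * exp (- (k + 2) * x)"
  have "- c * exp (- (k + 2) * x) \<le> G t" if x: "x \<ge> t" for x
  proof -
    have "G x \<le> G t"
    proof (rule DERIV_nonpos_imp_decreasing_open[OF x])
      show "continuous_on {t..x} G"
        unfolding G_def using t by (intro continuous_intros ode_solD(4)[OF sol]) auto
      fix z assume z: "t < z" "z < x"
      have pos: "u z > 0" using groundD(3)[OF g] z t by auto
      let ?D = "exp (- k * z) * (B * exp (- 2 * z) * u t powr p - rhs z (u z))"
      have e: "exp (- (k + 2) * z) = exp (- k * z) * exp (- 2 * z)"
        by (simp add: exp_add[symmetric] algebra_simps)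
      have "(G has_real_derivative (- k * exp (- k * z) * w z + exp (- k * z) * (k * w z - rhs z (u z)))
               + c * (k + 2) * exp (- (k + 2) * z)) (at z)"
        unfolding G_def using z t
        by (auto intro!: derivative_eq_intros ode_solD(2)[OF sol] simp: algebra_simps)
      moreover have "(- k * exp (- k * z) * w z + exp (- k * z) * (k * w z - rhs z (u z)))
               + c * (k + 2) * exp (- (k + 2) * z) = ?D"
        unfolding e mult.commute[of c] c by (simp add: algebra_simps)
      moreover have "?D \<le> 0"
      proof -
        have "u t powr p \<le> u z powr p"
          using ground_mono[OF g, of t z] z t p groundD(3)[OF g t] by (intro powr_mono2) auto
        also have "\<dots> \<le> lam * u z + u z powr p" using lam pos by simp
        finally have "B * exp (- 2 * z) * u t powr p \<le> rhs z (u z)"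
          unfolding rhs_pos_eq[OF pos] using B by (intro mult_left_mono) auto
        then show ?thesis by (intro mult_nonneg_nonpos) auto
      qed
      ultimately show "\<exists>y. (G has_real_derivative y) (at z) \<and> y \<le> 0" by auto
    qed
    moreover have "exp (- k * x) * w x \<ge> 0" using ground_deriv_nonneg[OF g, of x] x t by simp
    ultimately show ?thesis unfolding G_def by linarith
  qed
  then have "0 \<le> G t" using k by (intro nonneg_if_ge_decay[of "k + 2" t c]) auto
  then have "exp (- k * t) * (c * exp (- 2 * t)) \<le> exp (- k * t) * w t"
    unfolding G_def by (simp add: exp_add[symmetric] algebra_simps)
  then have "c * exp (- 2 * t) \<le> w t" by (simp only: mult_le_cancel_left_pos exp_gt_zero)
  then show ?thesis by (simp add: c_def)
qed

text \<open>The universal upper bound \<open>u = O(r powr (- 2 / (p - 1)))\<close> in the variable \<open>t\<close>.\<close>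

lemma ground_universal_bound:
  assumes g: "ground s u w" and t: "t > 0"
  shows "u t powr (p - 1) * exp (- 2 * t) \<le> 2 * (k + 2) / ((p - 1) * B)"
proof -
  note sol = groundD(1)[OF g]
  define c where "c = (p - 1) * B / (2 * (k + 2))"
  have c: "c > 0" using p B k by (simp add: c_def)
  \<comment> \<open>Separation of variables: divided by \<open>u powr p\<close>, the bound of
    \<open>ground_deriv_lower\<close> says exactly that this \<open>G\<close> is
    nonincreasing.\<close>
  define G where "G \<equiv> \<lambda>x. u x powr (1 - p) - c * exp (- 2 * x)"
  have "- c * exp (- 2 * x) \<le> G t" if x: "x \<ge> t" for x
  proof -
    have "G x \<le> G t"
    proof (rule DERIV_nonpos_imp_decreasing_open[OF x])
      have "u z \<noteq> 0" if "z \<in> {t..x}" for z using groundD(3)[OF g, of z] that t by auto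
      then show "continuous_on {t..x} G"
        unfolding G_def using t by (intro continuous_intros ode_solD(3)[OF sol]) auto
      fix z assume z: "t < z" "z < x"
      have pos: "u z > 0" using groundD(3)[OF g] z t by auto
      have "(G has_real_derivative (1 - p) * u z powr (- p) * w z + 2 * c * exp (- 2 * z)) (at z)"
        unfolding G_def using z t pos
        by (auto intro!: derivative_eq_intros ode_solD(1)[OF sol] simp: algebra_simps)
      moreover have "(1 - p) * u z powr (- p) * w z + 2 * c * exp (- 2 * z) \<le> 0"
      proof -
        have "u z powr (- p) * u z powr p = 1" using pos by (simp add: powr_minus)
        moreover have "2 * c = (p - 1) * B / (k + 2)" using k by (simp add: c_def field_simps)
        ultimately have "2 * c * exp (- 2 * z) = (p - 1) * (u z powr (- p) * u z powr p) * (B * exp (- 2 * z) / (k + 2))"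
          by simp
        also have "\<dots> = (p - 1) * u z powr (- p) * (B * u z powr p * exp (- 2 * z) / (k + 2))"
          by (simp add: mult_ac)
        also have "\<dots> \<le> (p - 1) * u z powr (- p) * w z"
          using p z t by (intro mult_left_mono ground_deriv_lower[OF g]) auto
        finally show ?thesis by (simp add: algebra_simps)
      qed
      ultimately show "\<exists>y. (G has_real_derivative y) (at z) \<and> y \<le> 0" by blast
    qed
    moreover have "u x powr (1 - p) \<ge> 0" by simp
    ultimately show ?thesis unfolding G_def by linarith
  qed
  then have "0 \<le> G t" by (intro nonneg_if_ge_decay[of 2 t c]) auto
  then have "c * exp (- 2 * t) \<le> u t powr (1 - p)" unfolding G_def by simp
  then have "u t powr (p - 1) * (c * exp (- 2 * t)) \<le> u t powr (p - 1) * u t powr (1 - p)"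
    by (intro mult_left_mono) auto
  also have "\<dots> = 1" using groundD(3)[OF g t] by (simp add: powr_add[symmetric])
  finally have "u t powr (p - 1) * exp (- 2 * t) \<le> 1 / c" using c by (simp add: field_simps)
  then show ?thesis by (simp add: c_def)
qed

text \<open>On \<open>[t - 1, t]\<close> the slope is at least \<open>exp (- k) * w t\<close>,
  because the damped slope is nonincreasing. Integration from \<open>u (t - 1) \<ge> 0\<close> gives
  the bound.\<close>

lemma ground_deriv_upper:
  assumes g: "ground s u w" and t: "t \<ge> 1"
  shows "w t \<le> exp k * u t"
proof -
  note sol = groundD(1)[OF g]
  define c where "c = exp (- k) * w t"
  have "u (t - 1) - c * (t - 1) \<le> u t - c * t"
  proof (rule DERIV_nonneg_imp_increasing_open[of "t - 1" t "\<lambda>x. u x - c * x"])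
    show "continuous_on {t - 1..t} (\<lambda>x. u x - c * x)"
      using t by (intro continuous_intros ode_solD(3)[OF sol]) auto
    fix x assume x: "t - 1 < x" "x < t"
    have "((\<lambda>x. u x - c * x) has_real_derivative w x - c) (at x)"
      using x t by (auto intro!: derivative_eq_intros ode_solD(1)[OF sol])
    moreover have "c \<le> w x"
    proof -
      have "exp (- k * t) * w t \<le> exp (- k * x) * w x"
        using x t by (intro ode_sol_damped_antimono[OF sol rhs_nonneg]) auto
      then have "exp (- k * (t - x)) * w t \<le> w x"
        by (simp add: exp_minus exp_diff field_simps)
      moreover have "exp (- k) * w t \<le> exp (- k * (t - x)) * w t"
        using x t k ground_deriv_nonneg[OF g, of t]
        by (intro mult_right_mono) (auto simp: mult_le_cancel_left1)
      ultimately show ?thesis by (simp add: c_def)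
    qed
    ultimately show "\<exists>y. ((\<lambda>x. u x - c * x) has_real_derivative y) (at x) \<and> 0 \<le> y" by force
  qed simp
  moreover have "u (t - 1) \<ge> 0"
    using groundD(3)[OF g, of "t - 1"] ode_solD(5)[OF sol] t by (cases "t = 1") auto
  ultimately have "exp (- k) * w t \<le> u t" by (simp add: c_def algebra_simps)
  then show ?thesis by (simp add: exp_minus field_simps)
qed

text \<open>The universal bound at \<open>t = 1\<close> and monotonicity confine \<open>u\<close> to
  \<open>[0, X]\<close> on the unit interval, whatever the slope. The source is then at most
  \<open>C\<close> there, so \<open>w\<close> stays above \<open>s - C\<close>, which forces
  \<open>s - C \<le> u 1 \<le> X\<close>.\<close>

lemma ground_slope_bounded: "\<exists>S. \<forall>s u w. ground s u w \<longrightarrow> s \<le> S"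
proof -
  define X where "X = (2 * (k + 2) / ((p - 1) * B) * exp 2) powr (1 / (p - 1))"
  define C where "C = B * (lam * X + X powr p)"
  have "s \<le> X + C" if g: "ground s u w" for s u w
  proof -
    note sol = groundD(1)[OF g]
    have u1: "u 1 \<le> X"
    proof -
      have "u 1 powr (p - 1) \<le> 2 * (k + 2) / ((p - 1) * B) * exp 2"
        using ground_universal_bound[OF g, of 1] by (simp add: exp_minus field_simps)
      then have "(u 1 powr (p - 1)) powr (1 / (p - 1)) \<le> X"
        unfolding X_def using p by (intro powr_mono2) auto
      then show ?thesis using p groundD(3)[OF g, of 1] by (simp add: powr_powr)
    qed
    have w: "s - C \<le> w t" if t: "0 \<le> t" "t \<le> 1" for t
    proof -
      have "w 0 + C * 0 \<le> w t + C * t"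
      proof (rule DERIV_nonneg_imp_increasing_open[OF t(1)])
        show "continuous_on {0..t} (\<lambda>x. w x + C * x)"
          by (intro continuous_intros ode_solD(4)[OF sol]) auto
        fix x assume x: "0 < x" "x < t"
        have D: "((\<lambda>x. w x + C * x) has_real_derivative k * w x - rhs x (u x) + C) (at x)"
          using x by (auto intro!: derivative_eq_intros ode_solD(2)[OF sol])
        have ux: "0 < u x" "u x \<le> X"
          using groundD(3)[OF g x(1)] ground_mono[OF g, of x 1] x t u1 by auto
        have "rhs x (u x) \<le> C"
        proof -
          have "B * exp (- 2 * x) * (lam * u x + u x powr p) \<le> B * 1 * (lam * X + X powr p)"
            using ux B lam p x by (intro mult_mono add_mono mult_left_mono powr_mono2) auto
          then show ?thesis unfolding rhs_pos_eq[OF ux(1)] C_def by simp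
        qed
        moreover have "k * w x \<ge> 0" using k ground_deriv_nonneg[OF g, of x] x by simp
        ultimately show "\<exists>y. ((\<lambda>x. w x + C * x) has_real_derivative y) (at x) \<and> 0 \<le> y"
          using D by (intro exI[of _ "k * w x - rhs x (u x) + C"]) auto
      qed
      moreover have "C * t \<le> C * 1"
        using t B lam unfolding C_def X_def by (intro mult_left_mono) auto
      ultimately show ?thesis using ode_solD(6)[OF sol] by simp
    qed
    have "u 0 - (s - C) * 0 \<le> u 1 - (s - C) * 1"
    proof (rule DERIV_nonneg_imp_increasing_open[of 0 1 "\<lambda>x. u x - (s - C) * x"])
      show "continuous_on {0..1} (\<lambda>x. u x - (s - C) * x)"
        by (intro continuous_intros ode_solD(3)[OF sol]) auto
      fix x :: real assume x: "0 < x" "x < 1"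
      have "((\<lambda>x. u x - (s - C) * x) has_real_derivative w x - (s - C)) (at x)"
        using x by (auto intro!: derivative_eq_intros ode_solD(1)[OF sol])
      then show "\<exists>y. ((\<lambda>x. u x - (s - C) * x) has_real_derivative y) (at x) \<and> 0 \<le> y"
        using w[of x] x by (intro exI[of _ "w x - (s - C)"]) auto
    qed simp
    then show ?thesis using u1 ode_solD(5)[OF sol] by simp
  qed
  then show ?thesis by blast
qed

end

section \<open>The Pohozaev functional\<close>

text \<open>The assumption is \<open>p > (N + 2) / (N - 2)\<close> rewritten with
  \<open>k = N - 2\<close>.\<close>

locale supercritical_emden = emden +
  assumes super: "4 / (p - 1) < k"
begin

text \<open>The scaling exponent: for \<open>r powr (- m)\<close>, that is for growth like
  \<open>exp (m * t)\<close>, the second derivative and the power term have the same order, which is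
  \<open>m_p\<close>.\<close>

definition m :: real where "m = 2 / (p - 1)"

lemma m_pos: "m > 0"
  using p by (simp add: m_def)

lemma m_super: "2 * m < k"
  using super by (simp add: m_def)

lemma m_p: "m * p = m + 2"
  using p by (simp add: m_def field_simps)

lemma ground_scaled_bound:
  assumes g: "ground s u w" and t: "t > 0"
  shows "exp (- m * t) * u t \<le> (2 * (k + 2) / ((p - 1) * B)) powr (1 / (p - 1))"
proof -
  have pos: "u t > 0" using groundD(3)[OF g t] .
  have "(exp (- m * t) * u t) powr (p - 1) = exp (- m * t * (p - 1)) * u t powr (p - 1)"
    using pos by (simp add: powr_mult exp_powr_real)
  also have "- m * t * (p - 1) = - 2 * t" using m_p by algebra
  finally have "(exp (- m * t) * u t) powr (p - 1) \<le> 2 * (k + 2) / ((p - 1) * B)"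
    using ground_universal_bound[OF g t] by (simp add: mult_ac)
  then have "((exp (- m * t) * u t) powr (p - 1)) powr (1 / (p - 1)) \<le>
      (2 * (k + 2) / ((p - 1) * B)) powr (1 / (p - 1))"
    using p by (intro powr_mono2) auto
  then show ?thesis using p pos by (simp add: powr_powr)
qed

text \<open>\<open>J\<close> is nondecreasing in \<open>t\<close>. If it were positive somewhere, then, \<open>N\<close> being a virial correction of
  it, \<open>N\<close> would grow linearly although all quantities are bounded. The inequality is \<open>J t \<le> 0\<close>.\<close>

lemma ground_log_derivative:
  assumes g: "ground s u w" and t: "t > 0" and small: "B * lam * exp (- 2 * t) \<le> (k - 2 * m) / 2"
  shows "(w t - m * u t)\<^sup>2 \<le> (m * (k - m) + B * lam * exp (- 2 * t)) * (u t)\<^sup>2"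
proof -
  note sol = groundD(1)[OF g]
  \<comment> \<open>In the scaled variables \<open>x\<close> and \<open>y\<close> below, the
    equation is autonomous up to \<open>\<epsilon>\<close>, with linear coefficients
    \<open>\<beta>\<close> and \<open>\<gamma>\<close>. Supercriticality is
    \<open>\<beta> > 0\<close>.\<close>
  define \<beta> \<gamma> where "\<beta> = k - 2 * m" and "\<gamma> = m * (k - m)"
  have \<beta>: "\<beta> > 0" and \<gamma>: "\<gamma> > 0" using m_super m_pos by (auto simp: \<beta>_def \<gamma>_def)
  define \<epsilon> where "\<epsilon> \<equiv> \<lambda>t. B * lam * exp (- 2 * t)"
  have \<epsilon>: "\<epsilon> z > 0" for z using B lam by (simp add: \<epsilon>_def)
  have \<epsilon>_le: "\<epsilon> z \<le> \<beta> / 2" if "z \<ge> t" for z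
  proof -
    have "\<epsilon> z \<le> \<epsilon> t" using that B lam by (simp add: \<epsilon>_def)
    with small show ?thesis by (simp add: \<epsilon>_def \<beta>_def)
  qed
  define x where "x \<equiv> \<lambda>t. exp (- m * t) * u t"
  define y where "y \<equiv> \<lambda>t. exp (- m * t) * (w t - m * u t)"
  have x_pos: "x z > 0" if "z > 0" for z using groundD(3)[OF g that] by (simp add: x_def)
  have dx: "(x has_real_derivative y z) (at z)" if "z > 0" for z
    unfolding x_def y_def using that
    by (auto intro!: derivative_eq_intros ode_solD(1)[OF sol] simp: algebra_simps)
  have dy: "(y has_real_derivative \<beta> * y z + \<gamma> * x z - \<epsilon> z * x z - B * x z powr p) (at z)" if z: "z > 0" for z
  proof -
    have pos: "u z > 0" by (rule groundD(3)[OF g z])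
    have "(y has_real_derivative - m * exp (- m * z) * (w z - m * u z)
            + exp (- m * z) * ((k * w z - rhs z (u z)) - m * w z)) (at z)"
      unfolding y_def using z
      by (auto intro!: derivative_eq_intros ode_solD(1,2)[OF sol] simp: algebra_simps)
    moreover have "exp (- m * z) * exp (- 2 * z) * u z powr p = x z powr p"
    proof -
      have "x z powr p = exp (- m * z * p) * u z powr p"
        using pos by (simp add: x_def powr_mult exp_powr_real)
      also have "- m * z * p = - m * z + - 2 * z" using m_p by algebra
      finally show ?thesis by (simp only: exp_add)
    qed
    then have "exp (- m * z) * rhs z (u z) = \<epsilon> z * x z + B * x z powr p"
      unfolding rhs_pos_eq[OF pos] \<epsilon>_def x_def by (simp add: algebra_simps)
    then have "- m * exp (- m * z) * (w z - m * u z) + exp (- m * z) * ((k * w z - rhs z (u z)) - m * w z)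
        = \<beta> * y z + \<gamma> * x z - \<epsilon> z * x z - B * x z powr p"
      unfolding \<beta>_def \<gamma>_def x_def y_def by (simp add: algebra_simps)
    ultimately show ?thesis by simp
  qed
  \<comment> \<open>The energy of the scaled equation with the sign of its \<open>\<epsilon>\<close>
    term reversed. With a plus sign the derivative would be
    \<open>\<beta> * (y z)\<^sup>2 - \<epsilon> z * (x z)\<^sup>2\<close>, of indefinite sign; the
    minus sign completes a square.\<close>
  define J where "J \<equiv> \<lambda>z. (y z)\<^sup>2 / 2 - \<gamma> * (x z)\<^sup>2 / 2 + B * x z powr (p + 1) / (p + 1) - \<epsilon> z * (x z)\<^sup>2 / 2"
  have dJ: "(J has_real_derivative (\<beta> - \<epsilon> z) * (y z)\<^sup>2 + \<epsilon> z * (x z - y z)\<^sup>2) (at z)" if z: "z > 0" for z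
  proof -
    define j where "j \<equiv> \<lambda>z. x z powr (p + 1)"
    have 1: "(j has_real_derivative (p + 1) * x z powr p * y z) (at z)"
      unfolding j_def using DERIV_fun_powr[OF dx[OF z] x_pos[OF z], of "p + 1"] by simp
    have 2: "(\<epsilon> has_real_derivative - 2 * \<epsilon> z) (at z)"
      unfolding \<epsilon>_def by (auto intro!: derivative_eq_intros)
    have J: "J = (\<lambda>z. (y z)\<^sup>2 / 2 - \<gamma> * (x z)\<^sup>2 / 2 + B * j z / (p + 1) - \<epsilon> z * (x z)\<^sup>2 / 2)"
      by (simp add: J_def j_def)
    show ?thesis
      unfolding J using p
      by (auto intro!: derivative_eq_intros dx[OF z] dy[OF z] 1 2)
         (simp add: power2_eq_square field_simps)
  qed
  have J_mono: "J t \<le> J z" if z: "t \<le> z" for z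
  proof (rule DERIV_nonneg_imp_nondecreasing[OF z])
    fix v assume v: "t \<le> v" "v \<le> z"
    have "0 \<le> (\<beta> - \<epsilon> v) * (y v)\<^sup>2 + \<epsilon> v * (x v - y v)\<^sup>2"
      using \<epsilon>_le[of v] \<epsilon>[of v] \<beta> v by (intro add_nonneg_nonneg mult_nonneg_nonneg) auto
    then show "\<exists>d. (J has_real_derivative d) (at v) \<and> 0 \<le> d"
      using dJ[of v] v t by (intro exI conjI) auto
  qed
  have "J t \<le> 0"
  proof (rule ccontr)
    assume "\<not> J t \<le> 0"
    then have J0: "J t > 0" by simp
    \<comment> \<open>The derivative of the first two terms contains
      \<open>B * x powr (p + 1)\<close>, just like \<open>(p + 1) * J\<close>. As \<open>J\<close>
      grows at least at the rate \<open>\<beta> / 2 * y\<^sup>2\<close>, the weight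
      \<open>(p + 3) / \<beta>\<close> is the one for which the \<open>y\<^sup>2\<close> terms
      cancel in the comparison; what remains is nonnegative.\<close>
    define N where "N \<equiv> \<lambda>z. \<beta> * (x z)\<^sup>2 / 2 - x z * y z + (p + 3) / \<beta> * J z"
    have growth: "N t + (p + 1) * J t * (z - t) \<le> N z" if z: "t \<le> z" for z
    proof -
      have "N t - (p + 1) * J t * t \<le> N z - (p + 1) * J t * z"
      proof (rule DERIV_nonneg_imp_nondecreasing[OF z])
        fix v assume v: "t \<le> v" "v \<le> z"
        then have v0: "v > 0" using t by simp
        let ?DK = "\<beta> * x v * y v - (y v)\<^sup>2 - x v * (\<beta> * y v + \<gamma> * x v - \<epsilon> v * x v - B * x v powr p)"
        let ?DJ = "(\<beta> - \<epsilon> v) * (y v)\<^sup>2 + \<epsilon> v * (x v - y v)\<^sup>2"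
        have D: "((\<lambda>z. N z - (p + 1) * J t * z) has_real_derivative
              ?DK + (p + 3) / \<beta> * ?DJ - (p + 1) * J t) (at v)"
        proof -
          have "((\<lambda>z. \<beta> * (x z)\<^sup>2 / 2 - x z * y z) has_real_derivative ?DK) (at v)"
            by (auto intro!: derivative_eq_intros dx[OF v0] dy[OF v0] simp: power2_eq_square)
          from DERIV_diff[OF DERIV_add[OF this DERIV_cmult[OF dJ[OF v0]]] DERIV_cmult_Id]
          show ?thesis unfolding N_def .
        qed
        have xp: "x v * x v powr p = x v powr (p + 1)"
          using x_pos[OF v0] by (simp add: powr_add)
        have K: "?DK = - (y v)\<^sup>2 - \<gamma> * (x v)\<^sup>2 + \<epsilon> v * (x v)\<^sup>2 + B * x v powr (p + 1)"
          unfolding xp[symmetric] by (simp add: power2_eq_square algebra_simps)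
        have J: "(p + 1) * J v = (p + 1) / 2 * ((y v)\<^sup>2 - \<gamma> * (x v)\<^sup>2 - \<epsilon> v * (x v)\<^sup>2) + B * x v powr (p + 1)"
          unfolding J_def using p by (simp add: field_simps)
        have "(p + 3) / \<beta> * (\<beta> / 2 * (y v)\<^sup>2) \<le> (p + 3) / \<beta> * ?DJ"
        proof (intro mult_left_mono)
          have "\<beta> / 2 * (y v)\<^sup>2 \<le> (\<beta> - \<epsilon> v) * (y v)\<^sup>2"
            using \<epsilon>_le[OF v(1)] by (intro mult_right_mono) auto
          moreover have "\<epsilon> v * (x v - y v)\<^sup>2 \<ge> 0" using \<epsilon>[of v] by simp
          ultimately show "\<beta> / 2 * (y v)\<^sup>2 \<le> ?DJ" by linarith
        qed (use p \<beta> in auto)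
        moreover have "(p + 3) / \<beta> * (\<beta> / 2 * (y v)\<^sup>2) = (p + 3) / 2 * (y v)\<^sup>2" using \<beta> by simp
        ultimately have DJ: "(p + 3) / 2 * (y v)\<^sup>2 \<le> (p + 3) / \<beta> * ?DJ" by linarith
        have "?DK + (p + 3) / 2 * (y v)\<^sup>2 - (p + 1) * J v
            = (p - 1) / 2 * (\<gamma> * (x v)\<^sup>2) + (p + 3) / 2 * (\<epsilon> v * (x v)\<^sup>2)"
          unfolding K J by (simp add: field_simps)
        also have "\<dots> \<ge> 0" using p \<gamma> \<epsilon>[of v] by (intro add_nonneg_nonneg mult_nonneg_nonneg) auto
        finally have "?DK + (p + 3) / 2 * (y v)\<^sup>2 - (p + 1) * J v \<ge> 0" .
        moreover have "(p + 1) * J t \<le> (p + 1) * J v"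
          using J_mono[OF v(1)] p by (intro mult_left_mono) auto
        ultimately have "0 \<le> ?DK + (p + 3) / \<beta> * ?DJ - (p + 1) * J t" using DJ by linarith
        with D show "\<exists>d. ((\<lambda>z. N z - (p + 1) * J t * z) has_real_derivative d) (at v) \<and> 0 \<le> d"
          by blast
      qed
      then show ?thesis by (simp add: algebra_simps)
    qed
    define X where "X = (2 * (k + 2) / ((p - 1) * B)) powr (1 / (p - 1))"
    define Y where "Y = (exp k + m) * X"
    define C where "C = \<beta> * X\<^sup>2 / 2 + X * Y + (p + 3) / \<beta> * (Y\<^sup>2 / 2 + B * X powr (p + 1) / (p + 1))"
    \<comment> \<open>The universal bound controls \<open>x\<close>, and
      \<open>ground_deriv_upper\<close> controls \<open>y\<close>; the latter needs
      \<open>z \<ge> 1\<close>.\<close>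
    have bound: "N z \<le> C" if z: "z \<ge> 1" for z
    proof -
      have z0: "z > 0" using z by simp
      have x: "0 < x z" "x z \<le> X"
        using x_pos[OF z0] ground_scaled_bound[OF g z0] by (auto simp: x_def X_def)
      have "\<bar>w z - m * u z\<bar> \<le> (exp k + m) * u z"
        using ground_deriv_nonneg[OF g, of z] ground_deriv_upper[OF g z] groundD(3)[OF g z0] z0 m_pos
        by (simp add: abs_le_iff algebra_simps) (smt (verit) mult_pos_pos exp_gt_zero)
      then have "\<bar>y z\<bar> \<le> exp (- m * z) * ((exp k + m) * u z)"
        unfolding y_def abs_mult by (simp add: mult_left_mono)
      also have "\<dots> = (exp k + m) * x z" by (simp add: x_def)
      also have "\<dots> \<le> Y" unfolding Y_def using x m_pos by (intro mult_left_mono) (auto simp: add_nonneg_nonneg)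
      finally have y: "\<bar>y z\<bar> \<le> Y" .
      have x2: "(x z)\<^sup>2 \<le> X\<^sup>2" using x by (intro power_mono) auto
      have y2: "(y z)\<^sup>2 \<le> Y\<^sup>2" using y by (metis abs_ge_zero power2_abs power_mono)
      have xy: "- (x z * y z) \<le> X * Y"
      proof -
        have "- (x z * y z) \<le> x z * \<bar>y z\<bar>" using x by (simp add: abs_if)
        also have "\<dots> \<le> X * Y" using x y by (intro mult_mono) auto
        finally show ?thesis .
      qed
      have "J z \<le> (y z)\<^sup>2 / 2 + B * x z powr (p + 1) / (p + 1)"
      proof -
        have "\<gamma> * (x z)\<^sup>2 \<ge> 0" "\<epsilon> z * (x z)\<^sup>2 \<ge> 0" using \<gamma> \<epsilon>[of z] by simp_all
        then show ?thesis unfolding J_def by linarith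
      qed
      also have "\<dots> \<le> Y\<^sup>2 / 2 + B * X powr (p + 1) / (p + 1)"
        using y2 x p B by (intro add_mono divide_right_mono mult_left_mono powr_mono2) auto
      finally have "(p + 3) / \<beta> * J z \<le> (p + 3) / \<beta> * (Y\<^sup>2 / 2 + B * X powr (p + 1) / (p + 1))"
        using p \<beta> by (intro mult_left_mono) auto
      moreover have "\<beta> * (x z)\<^sup>2 / 2 \<le> \<beta> * X\<^sup>2 / 2" using x2 \<beta> by simp
      ultimately show ?thesis unfolding N_def C_def using xy by linarith
    qed
    define z where "z = max t 1 + (\<bar>C\<bar> + \<bar>N t\<bar> + 1) / ((p + 1) * J t)"
    have pJ: "(p + 1) * J t > 0" using J0 p by simp
    have q: "(\<bar>C\<bar> + \<bar>N t\<bar> + 1) / ((p + 1) * J t) \<ge> 0" using pJ by simp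
    then have z: "z \<ge> t" "z \<ge> 1" unfolding z_def by auto
    have "\<bar>C\<bar> + \<bar>N t\<bar> + 1 = (p + 1) * J t * ((\<bar>C\<bar> + \<bar>N t\<bar> + 1) / ((p + 1) * J t))"
      using pJ by (metis less_irrefl nonzero_mult_div_cancel_left times_divide_eq_right)
    also have "\<dots> \<le> (p + 1) * J t * (z - t)"
      using pJ by (intro mult_left_mono) (auto simp: z_def)
    finally have "N t + (\<bar>C\<bar> + \<bar>N t\<bar> + 1) \<le> C" using growth[OF z(1)] bound[OF z(2)] by linarith
    then show False by linarith
  qed
  \<comment> \<open>Discarding the power term from \<open>J t \<le> 0\<close> leaves the claim in
    scaled variables.\<close>
  moreover have "B * x t powr (p + 1) / (p + 1) \<ge> 0" using B p by simp
  ultimately have "(y t)\<^sup>2 \<le> (\<gamma> + \<epsilon> t) * (x t)\<^sup>2"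
    unfolding J_def by (simp add: algebra_simps)
  then have "(exp (- m * t))\<^sup>2 * (w t - m * u t)\<^sup>2 \<le> (exp (- m * t))\<^sup>2 * ((\<gamma> + \<epsilon> t) * (u t)\<^sup>2)"
    unfolding x_def y_def by (simp add: power_mult_distrib mult_ac)
  then show ?thesis
    unfolding \<gamma>_def \<epsilon>_def by (subst (asm) mult_le_cancel_left_pos) auto
qed

end

section \<open>Comparison with a ball solution\<close>

context emden
begin

text \<open>The factor \<open>exp (- k * t)\<close> cancels the first-order term of the equation,
  and the \<open>lam\<close> terms cancel between the two solutions, so that only the powers
  contribute to the derivative. Up to a positive factor this is the derivative of
  \<open>u / v\<close>.\<close>

definition wronskian :: "(real \<Rightarrow> real) \<Rightarrow> (real \<Rightarrow> real) \<Rightarrow> (real \<Rightarrow> real) \<Rightarrow> (real \<Rightarrow> real) \<Rightarrow> real \<Rightarrow> real" where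
  "wronskian u w v y t = exp (- k * t) * (v t * w t - u t * y t)"

lemma wronskian_0:
  assumes "sol s u w" "sol s' v y"
  shows "wronskian u w v y 0 = 0"
  using ode_solD(5)[OF assms(1)] ode_solD(5)[OF assms(2)] by (simp add: wronskian_def)

lemma continuous_on_wronskian:
  assumes "sol s u w" "sol s' v y" "a \<ge> 0"
  shows "continuous_on {a..b} (wronskian u w v y)"
  unfolding wronskian_def[abs_def] using assms(3)
  by (intro continuous_intros ode_solD(3,4)[OF assms(1)] ode_solD(3,4)[OF assms(2)])

lemma wronskian_deriv:
  assumes u: "sol s u w" and v: "sol s' v y" and t: "t > 0" and pos: "u t > 0" "v t > 0"
  shows "(wronskian u w v y has_real_derivative
           B * exp (- (k + 2) * t) * (u t * v t powr p - v t * u t powr p)) (at t)"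
proof -
  have "(wronskian u w v y has_real_derivative
      - k * exp (- k * t) * (v t * w t - u t * y t) +
      exp (- k * t) * ((y t * w t + v t * (k * w t - rhs t (u t))) - (w t * y t + u t * (k * y t - rhs t (v t))))) (at t)"
    unfolding wronskian_def[abs_def]
    by (auto intro!: derivative_eq_intros ode_solD(1,2)[OF u t] ode_solD(1,2)[OF v t] simp: algebra_simps)
  also have "- k * exp (- k * t) * (v t * w t - u t * y t) +
      exp (- k * t) * ((y t * w t + v t * (k * w t - rhs t (u t))) - (w t * y t + u t * (k * y t - rhs t (v t))))
      = exp (- k * t) * (u t * rhs t (v t) - v t * rhs t (u t))"
    by (simp add: algebra_simps)
  also have "\<dots> = B * (exp (- k * t) * exp (- 2 * t)) * (u t * v t powr p - v t * u t powr p)"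
    unfolding rhs_pos_eq[OF pos(1)] rhs_pos_eq[OF pos(2)] by (simp add: algebra_simps)
  also have "exp (- k * t) * exp (- 2 * t) = exp (- (k + 2) * t)"
    by (simp add: exp_add[symmetric] algebra_simps)
  finally show ?thesis .
qed

lemma quotient_deriv:
  assumes u: "sol s u w" and v: "sol s' v y" and t: "t > 0" and pos: "v t > 0"
  shows "((\<lambda>t. u t / v t) has_real_derivative exp (k * t) * wronskian u w v y t / (v t)\<^sup>2) (at t)"
proof -
  have "((\<lambda>t. u t / v t) has_real_derivative (w t * v t - u t * y t) / (v t * v t)) (at t)"
    using pos by (intro DERIV_divide ode_solD(1)[OF u t] ode_solD(1)[OF v t]) auto
  moreover have "exp (k * t) * wronskian u w v y t = w t * v t - u t * y t"
    unfolding wronskian_def mult.assoc[symmetric] by (simp add: exp_add[symmetric])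
  ultimately show ?thesis by (simp add: power2_eq_square)
qed

lemma powr_cross_mono:
  fixes a b :: real
  assumes "0 < a" "a \<le> b"
  shows "b * a powr p \<le> a * b powr p"
proof -
  have e: "x powr p = x * x powr (p - 1)" if "x > 0" for x :: real
    using powr_add[of x 1 "p - 1"] that by simp
  have "a powr (p - 1) \<le> b powr (p - 1)" using assms p by (intro powr_mono2) auto
  then have "a * b * a powr (p - 1) \<le> a * b * b powr (p - 1)"
    using assms by (intro mult_left_mono) auto
  then show ?thesis using e[of a] e[of b] assms by (simp add: mult_ac)
qed

section \<open>Sturm comparison of a solution lying below a ground solution\<close>

context
  fixes s u w s' v y T
  assumes u: "sol s u w" and v: "ground s' v y"
    and pos: "\<And>t. 0 < t \<Longrightarrow> t < T \<Longrightarrow> 0 < u t" and le: "\<And>t. 0 < t \<Longrightarrow> t < T \<Longrightarrow> u t \<le> v t"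
begin

text \<open>Superlinearity, in the form of \<open>powr_cross_mono\<close>, gives the derivative a
  sign as long as \<open>0 < u \<le> v\<close>. As the Wronskian starts at zero, it is nonnegative
  and \<open>u / v\<close> is nondecreasing.\<close>

lemma wronskian_mono:
  assumes t: "0 \<le> a" "a \<le> b" "b \<le> T"
  shows "wronskian u w v y a \<le> wronskian u w v y b"
proof (rule DERIV_nonneg_imp_increasing_open[OF t(2)])
  show "continuous_on {a..b} (wronskian u w v y)"
    by (rule continuous_on_wronskian[OF u groundD(1)[OF v] t(1)])
  fix x assume x: "a < x" "x < b"
  have "B * exp (- (k + 2) * x) * (u x * v x powr p - v x * u x powr p) \<ge> 0"
    using powr_cross_mono[OF pos[of x] le[of x]] x t B by (intro mult_nonneg_nonneg) auto
  then show "\<exists>d. (wronskian u w v y has_real_derivative d) (at x) \<and> 0 \<le> d"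
    using wronskian_deriv[OF u groundD(1)[OF v] _ pos[of x] groundD(3)[OF v, of x]] x t by (intro exI conjI) auto
qed

lemma wronskian_nonneg: "0 \<le> t \<Longrightarrow> t \<le> T \<Longrightarrow> 0 \<le> wronskian u w v y t"
  using wronskian_mono[of 0 t] wronskian_0[OF u groundD(1)[OF v]] by simp

lemma quotient_continuous_on: "0 < a \<Longrightarrow> continuous_on {a..b} (\<lambda>t. u t / v t)"
  using groundD(3)[OF v]
  by (intro continuous_on_divide ode_solD(3)[OF u] ode_solD(3)[OF groundD(1)[OF v]]) (auto simp: less_imp_neq[symmetric] dest: less_le_trans)

lemma quotient_mono:
  assumes t: "0 < a" "a \<le> b" "b \<le> T"
  shows "u a / v a \<le> u b / v b"
proof (rule DERIV_nonneg_imp_increasing_open[OF t(2) _ quotient_continuous_on[OF t(1)]])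
  fix x assume x: "a < x" "x < b"
  have "exp (k * x) * wronskian u w v y x / (v x)\<^sup>2 \<ge> 0"
    using wronskian_nonneg[of x] x t by simp
  then show "\<exists>d. ((\<lambda>t. u t / v t) has_real_derivative d) (at x) \<and> 0 \<le> d"
    using quotient_deriv[OF u groundD(1)[OF v] _ groundD(3)[OF v], of x] x t by (intro exI conjI) auto
qed

text \<open>On \<open>[a, b]\<close> the derivative of \<open>u / v\<close> is at most
  \<open>exp (k * x) * wronskian u w v y b / (v a)\<^sup>2\<close>, since the Wronskian and
  \<open>v\<close> are both nondecreasing. Integrating the exponential produces the factor
  \<open>1 / k\<close>.\<close>

lemma quotient_growth:
  assumes t: "0 < a" "a \<le> b" "b \<le> T"
  shows "u b / v b \<le> u a / v a + wronskian u w v y b * (exp (k * b) / (k * (v a)\<^sup>2))"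
proof -
  define c where "c = wronskian u w v y b / (k * (v a)\<^sup>2)"
  have va: "v a > 0" using groundD(3)[OF v t(1)] .
  have c: "c \<ge> 0" using wronskian_nonneg[of b] t k by (simp add: c_def)
  have "u b / v b - c * exp (k * b) \<le> u a / v a - c * exp (k * a)"
  proof (rule DERIV_nonpos_imp_decreasing_open[of a b "\<lambda>t. u t / v t - c * exp (k * t)"])
    show "continuous_on {a..b} (\<lambda>t. u t / v t - c * exp (k * t))"
      by (intro continuous_on_diff quotient_continuous_on t continuous_intros)
    fix x assume x: "a < x" "x < b"
    have x0: "x > 0" using x t by simp
    have "((\<lambda>t. u t / v t - c * exp (k * t)) has_real_derivative
        exp (k * x) * wronskian u w v y x / (v x)\<^sup>2 - c * (exp (k * x) * k)) (at x)"
      by (intro DERIV_diff quotient_deriv[OF u groundD(1)[OF v] x0 groundD(3)[OF v x0]])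
         (auto intro!: derivative_eq_intros)
    moreover have "exp (k * x) * wronskian u w v y x / (v x)\<^sup>2 \<le> exp (k * x) * wronskian u w v y b / (v a)\<^sup>2"
      using wronskian_mono[of x b] wronskian_nonneg[of x] ground_mono[OF v, of a x] va x x0 t
      by (intro frac_le mult_left_mono power_mono mult_nonneg_nonneg) auto
    moreover have "exp (k * x) * wronskian u w v y b / (v a)\<^sup>2 = c * (exp (k * x) * k)"
      using k by (simp add: c_def)
    ultimately show "\<exists>d. ((\<lambda>t. u t / v t - c * exp (k * t)) has_real_derivative d) (at x) \<and> d \<le> 0"
      by (intro exI conjI) auto
  qed (use t in auto)
  moreover have "c * exp (k * a) \<ge> 0" using c by simp
  ultimately show ?thesis by (simp add: c_def)
qed

text \<open>Below \<open>v / 2\<close> the power of \<open>u\<close> consumes at most the fraction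
  \<open>2 powr (1 - p)\<close> of the positive term in the Wronskian's derivative. Since
  \<open>u / v\<close> is nondecreasing, this derivative is at least a constant times
  \<open>u a / v a\<close>, so the Wronskian controls the initial quotient.\<close>

lemma wronskian_growth:
  assumes t: "0 < a" "a \<le> b" "b \<le> T" and half: "\<And>t. 0 < t \<Longrightarrow> t < T \<Longrightarrow> u t \<le> v t / 2"
  shows "(b - a) * (B * exp (- (k + 2) * b) * (1 - 2 powr (1 - p)) * v a powr (p + 1)) * (u a / v a)
           \<le> wronskian u w v y b"
proof -
  define h where "h = 1 - (2::real) powr (1 - p)"
  have h: "h \<ge> 0" using p powr_mono[of "1 - p" 0 "2::real"] by (simp add: h_def)
  define c where "c = B * exp (- (k + 2) * b) * h * v a powr (p + 1) * (u a / v a)"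
  have va: "v a > 0" using groundD(3)[OF v t(1)] .
  have "wronskian u w v y a - c * a \<le> wronskian u w v y b - c * b"
  proof (rule DERIV_nonneg_imp_increasing_open[of a b "\<lambda>t. wronskian u w v y t - c * t"])
    show "continuous_on {a..b} (\<lambda>t. wronskian u w v y t - c * t)"
      using t by (intro continuous_on_diff continuous_on_wronskian[OF u groundD(1)[OF v]] continuous_intros) auto
    fix x assume x: "a < x" "x < b"
    have x0: "0 < x" "x < T" using x t by auto
    note ux = pos[OF x0] and vx = groundD(3)[OF v x0(1)]
    have "c \<le> B * exp (- (k + 2) * x) * (u x * v x powr p - v x * u x powr p)"
    proof -
      have e: "z powr p = z * z powr (p - 1)" if "z > 0" for z :: real
        using powr_add[of z 1 "p - 1"] that by simp
      have "u x powr (p - 1) \<le> (v x / 2) powr (p - 1)"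
        using half[OF x0] ux p by (intro powr_mono2) auto
      also have "\<dots> = 2 powr (1 - p) * v x powr (p - 1)"
        using vx powr_minus_divide[of 2 "p - 1"] by (simp add: powr_divide)
      finally have "v x * u x * u x powr (p - 1) \<le> v x * u x * (2 powr (1 - p) * v x powr (p - 1))"
        using ux vx by (intro mult_left_mono) auto
      then have "v x * u x powr p \<le> 2 powr (1 - p) * (u x * v x powr p)"
        using e[OF ux] e[OF vx] by (simp add: mult_ac)
      then have 1: "h * (u x * v x powr p) \<le> u x * v x powr p - v x * u x powr p"
        by (simp add: h_def algebra_simps)
      have va_le: "v a \<le> v x" using ground_mono[OF v, of a x] x t by auto
      have "u a / v a * v a \<le> u x / v x * v x"
        using quotient_mono[of a x] va_le va x t ux vx by (intro mult_mono) auto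
      then have "u a / v a * v a \<le> u x" using vx by simp
      moreover have "v a powr p \<le> v x powr p" using va va_le p by (intro powr_mono2) auto
      ultimately have "(u a / v a * v a) * v a powr p \<le> u x * v x powr p"
        using ux by (intro mult_mono) auto
      then have 2: "v a powr (p + 1) * (u a / v a) \<le> u x * v x powr p"
        using va by (simp add: powr_add mult_ac)
      have "c = B * exp (- (k + 2) * b) * (h * (v a powr (p + 1) * (u a / v a)))"
        by (simp add: c_def)
      also have "\<dots> \<le> B * exp (- (k + 2) * x) * (u x * v x powr p - v x * u x powr p)"
      proof (intro mult_mono)
        show "exp (- (k + 2) * b) \<le> exp (- (k + 2) * x)" using x k by simp
        show "h * (v a powr (p + 1) * (u a / v a)) \<le> u x * v x powr p - v x * u x powr p"
          using mult_left_mono[OF 2 h] 1 by linarith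
        show "0 \<le> h * (v a powr (p + 1) * (u a / v a))"
          using h va pos[of a] t x by (intro mult_nonneg_nonneg divide_nonneg_nonneg) auto
      qed (use B in auto)
      finally show ?thesis .
    qed
    then show "\<exists>d. ((\<lambda>t. wronskian u w v y t - c * t) has_real_derivative d) (at x) \<and> 0 \<le> d"
      using DERIV_diff[OF wronskian_deriv[OF u groundD(1)[OF v] x0(1) ux vx] DERIV_cmult_Id[of c]]
      by (intro exI conjI) auto
  qed (use t in auto)
  moreover have "wronskian u w v y a \<ge> 0" using t by (intro wronskian_nonneg) auto
  ultimately have "(b - a) * c \<le> wronskian u w v y b" by (simp add: algebra_simps)
  then show ?thesis by (simp add: c_def h_def mult_ac)
qed

end

text \<open>On \<open>(0, T]\<close> the ground solution lies above a line \<open>c * t\<close>,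
  whereas \<open>u\<close> is at most \<open>s * t * exp (k * T)\<close>, which gives the upper
  bound for small \<open>s\<close>. Positivity follows because \<open>u / v\<close> is nondecreasing
  up to a first zero and so cannot return to zero.\<close>

lemma small_slope_half_ground:
  assumes v: "ground s' v y" and T: "T > 0"
  shows "\<exists>s0>0. s0 < s' \<and> (\<forall>s u w. 0 < s \<and> s \<le> s0 \<and> sol s u w \<longrightarrow> (\<forall>t. 0 < t \<and> t \<le> T \<longrightarrow> 0 < u t \<and> u t \<le> v t / 2))"
proof -
  have s': "s' > 0" by (rule groundD(2)[OF v])
  obtain d0 where d0: "d0 > 0" "\<And>t. 0 < t \<Longrightarrow> t \<le> d0 \<Longrightarrow> s' / 2 * t < v t"
    using ode_sol_positive_initially[OF groundD(1)[OF v] s'] by blast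
  define d where "d = min d0 T"
  have d: "0 < d" "d \<le> d0" "d \<le> T" using d0 T by (auto simp: d_def)
  \<comment> \<open>Chosen so that \<open>c * T = s' / 2 * d\<close>: the line lies below
    \<open>s' / 2 * t\<close> up to \<open>d\<close> and below \<open>v d\<close>
    afterwards.\<close>
  define c where "c = s' * d / (2 * T)"
  have c: "c > 0" "c \<le> s' / 2" using s' d T by (auto simp: c_def field_simps)
  have vc: "c * t \<le> v t" if t: "0 < t" "t \<le> T" for t
  proof (cases "t \<le> d")
    case True
    have "c * t \<le> s' / 2 * t" using c t by (intro mult_right_mono) auto
    also have "\<dots> \<le> v t" using d0(2)[of t] True t d by simp
    finally show ?thesis .
  next
    case False
    have "c * t \<le> c * T" using c t by simp
    also have "\<dots> = s' / 2 * d" using T by (simp add: c_def)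
    also have "\<dots> \<le> v d" using d0(2)[of d] d by simp
    also have "\<dots> \<le> v t" using ground_mono[OF v, of d t] False d by simp
    finally show ?thesis .
  qed
  define s0 where "s0 = min (c / 2 * exp (- k * T)) (s' / 2)"
  have "0 < u t \<and> u t \<le> v t / 2" if s: "0 < s" "s \<le> s0" and u: "sol s u w" and t: "0 < t" "t \<le> T" for s u w t
  proof -
    have half: "u t \<le> v t / 2" if t: "0 < t" "t \<le> T" for t
    proof -
      have "u t \<le> s * t * exp (k * t)"
        using s k t by (intro ode_sol_growth[OF u rhs_nonneg]) auto
      also have "\<dots> \<le> (c / 2 * exp (- k * T)) * t * exp (k * T)"
        using s k t c by (intro mult_mono) (auto simp: s0_def)
      also have "\<dots> = c * t / 2" by (simp add: exp_minus)
      also have "\<dots> \<le> v t / 2" using vc[OF t] by simp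
      finally show ?thesis .
    qed
    have "0 < u t"
    proof (rule ccontr)
      assume "\<not> 0 < u t"
      obtain e0 where e0: "e0 > 0" "\<And>t. 0 < t \<Longrightarrow> t \<le> e0 \<Longrightarrow> s / 2 * t < u t"
        using ode_sol_positive_initially[OF u s(1)] by blast
      define e where "e = min e0 t"
      have e: "0 < e" "e \<le> e0" "e \<le> t" using e0 t by (auto simp: e_def)
      have ue: "u e > 0" using e0(2)[OF e(1,2)] mult_pos_pos[of "s / 2" e] s e by linarith
      obtain c where c: "e \<le> c" "c \<le> t" "u c = 0"
        using IVT2'[of u t 0 e] \<open>\<not> 0 < u t\<close> ue e ode_solD(3)[OF u, of e t] by auto
      have pos: "0 < u z" if "0 < z" "z < c" for z
        using ode_sol_negative_after_zero[OF u rhs_nonneg s(1), of z c] that c by fastforce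
      have "u (c / 2) / v (c / 2) \<le> u c / v c"
        using c e t half groundD(3)[OF v]
        by (intro quotient_mono[OF u v, of c] pos) (auto intro: order_trans[OF half])
      moreover have "u (c / 2) / v (c / 2) > 0"
        using pos[of "c / 2"] groundD(3)[OF v, of "c / 2"] c e by simp
      ultimately show False using c by simp
    qed
    with half[OF t] show ?thesis by simp
  qed
  moreover have "s0 > 0" "s0 < s'" using c s' by (auto simp: s0_def)
  ultimately show ?thesis by blast
qed

end

section \<open>Counting sign changes\<close>

lemma ode_sol_slope_pos:
  assumes sol: "ode_sol k f s u w" and f: "\<And>t x. f t x \<ge> 0" and t: "t > 0" "u t > 0"
  shows "s > 0"
proof (rule ccontr)
  assume "\<not> s > 0"
  have w: "w x \<le> 0" if "x \<ge> 0" for x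
  proof -
    have "exp (- k * x) * w x \<le> 0"
      using ode_sol_damped_antimono[OF sol f order_refl that] ode_solD(6)[OF sol] \<open>\<not> s > 0\<close> by simp
    then show ?thesis by (simp add: mult_le_0_iff)
  qed
  have "u t \<le> u 0"
  proof (rule DERIV_nonpos_imp_decreasing_open[of 0 t u])
    show "\<exists>y. (u has_real_derivative y) (at x) \<and> y \<le> 0" if "0 < x" for x
      using ode_solD(1)[OF sol that] w[of x] that by auto
  qed (use t ode_solD(3)[OF sol, of 0 t] in auto)
  then show False using ode_solD(5)[OF sol] t by simp
qed

text \<open>The slope is the limit of \<open>u t / t\<close> at zero. This turns distinct slopes
  into distinct solutions.\<close>

lemma ode_sol_slope_unique:
  assumes u: "ode_sol k f s u w" and v: "ode_sol k f s' v y" and T: "T > 0"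
    and eq: "\<And>t. 0 < t \<Longrightarrow> t < T \<Longrightarrow> u t = v t"
  shows "s = s'"
proof -
  have lim: "((\<lambda>t. z t / t) \<longlongrightarrow> r) (at_right 0)" if "ode_sol k f r z x" for r z x
  proof -
    have "(z has_real_derivative r) (at 0 within {0..})"
      using that by (auto simp: ode_sol_def)
    then show ?thesis
      using ode_solD(5)[OF that] by (simp add: has_field_derivative_iff at_within_Ici_at_right)
  qed
  have "\<forall>\<^sub>F t in at_right 0. u t / t = v t / t"
    using eventually_at_right_less[of 0] eventually_at_right_real[OF T]
    by eventually_elim (use eq in auto)
  from tendsto_cong[THEN iffD1, OF this lim[OF u]] lim[OF v] show ?thesis
    by (rule tendsto_unique[OF trivial_limit_at_right_real])
qed

section \<open>Growth of solutions far below a bounded ground solution\<close>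

context emden
begin

text \<open>Such solutions grow almost like the fundamental solution \<open>exp (k * t)\<close>.
  Late in time \<open>v\<close> is nearly constant, so \<open>quotient_growth\<close> bounds
  \<open>u T / v T\<close> by about \<open>exp (k * T) / (k * M\<^sup>2)\<close> times the Wronskian
  at \<open>T\<close>, while \<open>exp (k * T)\<close> times that Wronskian is at most
  \<open>v T * w T\<close>. The threshold \<open>T0\<close> is independent of the solution.\<close>

lemma half_ground_log_derivative:
  assumes v: "ground s' v y" and bd: "\<And>t. t > 0 \<Longrightarrow> v t \<le> D" and \<theta>: "0 < \<theta>" "\<theta> < k"
  shows "\<exists>T0>0. \<forall>T\<ge>T0. \<forall>s u w. sol s u w \<longrightarrow> (\<forall>t. 0 < t \<and> t \<le> T \<longrightarrow> 0 < u t \<and> u t \<le> v t / 2) \<longrightarrow>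
           \<theta> * u T \<le> w T"
proof -
  define M where "M = (SUP t\<in>{0<..}. v t)"
  have bdd: "bdd_above (v ` {0<..})" using bd by (intro bdd_aboveI2[of _ _ D]) auto
  have vM: "v t \<le> M" if "t > 0" for t
    unfolding M_def using that by (intro cSUP_upper bdd) auto
  have M: "M > 0" using vM[of 1] groundD(3)[OF v, of 1] by simp
  \<comment> \<open>The margin between \<open>\<theta>\<close> and \<open>k\<close> is split in two:
    \<open>\<theta>' < k\<close> absorbs the difference between \<open>v b\<close> and its supremum
    \<open>M\<close>, and \<open>\<theta> < \<theta>'\<close> absorbs the fixed constant
    \<open>A\<close>.\<close>
  define \<theta>' where "\<theta>' = (\<theta> + k) / 2"
  have \<theta>': "\<theta> < \<theta>'" "\<theta>' < k" "\<theta>' > 0" using \<theta> by (auto simp: \<theta>'_def)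
  have "sqrt (\<theta>' / k) * M < 1 * M"
    using \<theta>' k M by (intro mult_strict_right_mono) auto
  then obtain t2 where t2: "t2 > 0" "sqrt (\<theta>' / k) * M < v t2"
    using less_cSUP_iff[OF _ bdd, of "sqrt (\<theta>' / k) * M"] unfolding M_def by auto
  define b where "b = max t2 2"
  have b: "b \<ge> 2" by (simp add: b_def)
  have vb: "v b > 0" using groundD(3)[OF v, of b] b by simp
  have "sqrt (\<theta>' / k) * M < v b"
    using t2 ground_mono[OF v, of t2 b] by (simp add: b_def)
  then have "(sqrt (\<theta>' / k) * M)\<^sup>2 < (v b)\<^sup>2"
    using M \<theta>' k by (intro power_strict_mono) auto
  then have vb2: "\<theta>' * M\<^sup>2 < k * (v b)\<^sup>2"
    using \<theta>' k by (simp add: power_mult_distrib field_simps)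
  have h: "1 - (2::real) powr (1 - p) > 0"
    using p powr_less_mono[of "1 - p" 0 "2::real"] by simp
  have v1: "v 1 > 0" using groundD(3)[OF v, of 1] by simp
  define c where "c = (b - 1) * (B * exp (- (k + 2) * b) * (1 - 2 powr (1 - p)) * v 1 powr (p + 1))"
  have c: "c > 0" unfolding c_def using b B h v1 by (intro mult_pos_pos) auto
  define A where "A = 1 / c + exp (k * b) / (k * (v 1)\<^sup>2)"
  \<comment> \<open>For \<open>T \<ge> Q / k\<close> one has \<open>exp (k * T) \<ge> Q\<close>,
    which makes the contribution of \<open>A\<close> at most
    \<open>(1 - \<theta> / \<theta>') * exp (k * T)\<close>.\<close>
  define Q where "Q = \<theta> * M\<^sup>2 * A / (1 - \<theta> / \<theta>')"
  define T0 where "T0 = max b (Q / k)"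
  have "\<theta> * u T \<le> w T" if T: "T \<ge> T0" and u: "sol s u w"
    and half: "\<And>t. 0 < t \<Longrightarrow> t \<le> T \<Longrightarrow> 0 < u t \<and> u t \<le> v t / 2" for T s u w
  proof -
    have Tb: "T \<ge> b" "T \<ge> 2" using T b by (auto simp: T0_def)
    have pos: "0 < u t" if "0 < t" "t \<le> T" for t using half[OF that] by simp
    have vpos: "v t > 0" if "t > 0" for t using groundD(3)[OF v that] .
    have le: "u t \<le> v t" if "0 < t" "t \<le> T" for t
      using half[OF that] vpos[OF that(1)] by linarith
    define W where "W = wronskian u w v y"
    have W0: "W T \<ge> 0"
      unfolding W_def using Tb by (intro wronskian_nonneg[OF u v, of T] pos le) auto
    have W_le: "W b \<le> W T"
      unfolding W_def using Tb b by (intro wronskian_mono[OF u v, of T] pos le) auto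
    have "c * (u 1 / v 1) \<le> W b"
      unfolding W_def c_def using Tb b half by (intro wronskian_growth[OF u v, of T] pos le) auto
    then have "u 1 / v 1 \<le> W T * (1 / c)" using c W_le by (simp add: field_simps)
    moreover have "u b / v b \<le> u 1 / v 1 + W b * (exp (k * b) / (k * (v 1)\<^sup>2))"
      unfolding W_def using Tb b by (intro quotient_growth[OF u v, of T] pos le) auto
    moreover have "W b * (exp (k * b) / (k * (v 1)\<^sup>2)) \<le> W T * (exp (k * b) / (k * (v 1)\<^sup>2))"
      using W_le k by (intro mult_right_mono) auto
    ultimately have "u b / v b \<le> W T * A" by (simp add: A_def algebra_simps)
    moreover have "u T / v T \<le> u b / v b + W T * (exp (k * T) / (k * (v b)\<^sup>2))"
      unfolding W_def using Tb b by (intro quotient_growth[OF u v, of T] pos le) auto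
    ultimately have gT: "u T / v T \<le> W T * (A + exp (k * T) / (k * (v b)\<^sup>2))"
      by (simp add: algebra_simps)
    have "\<theta> * M\<^sup>2 * (A + exp (k * T) / (k * (v b)\<^sup>2)) \<le> exp (k * T)"
    proof -
      have "Q \<le> k * T" using T k by (simp add: T0_def field_simps)
      also have "\<dots> \<le> exp (k * T)" using exp_ge_add_one_self[of "k * T"] by linarith
      finally have 1: "\<theta> * M\<^sup>2 * A \<le> (1 - \<theta> / \<theta>') * exp (k * T)"
        using \<theta>' by (simp add: Q_def field_simps)
      have "\<theta> * M\<^sup>2 / (k * (v b)\<^sup>2) \<le> \<theta> * M\<^sup>2 / (\<theta>' * M\<^sup>2)"
        using vb2 \<theta> \<theta>' M k vb by (intro divide_left_mono mult_pos_pos) auto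
      then have "\<theta> * M\<^sup>2 / (k * (v b)\<^sup>2) \<le> \<theta> / \<theta>'" using M by simp
      then have "\<theta> * M\<^sup>2 / (k * (v b)\<^sup>2) * exp (k * T) \<le> \<theta> / \<theta>' * exp (k * T)"
        by (intro mult_right_mono) auto
      with 1 show ?thesis by (simp add: algebra_simps)
    qed
    then have 2: "W T * (\<theta> * M\<^sup>2 * (A + exp (k * T) / (k * (v b)\<^sup>2))) \<le> W T * exp (k * T)"
      using W0 by (rule mult_left_mono)
    have vT: "v T > 0" "v T \<le> M" using vpos[of T] vM[of T] Tb by auto
    have uT: "u T > 0" using pos[of T] Tb by simp
    have "\<theta> * u T * v T = \<theta> * (u T / v T) * (v T)\<^sup>2" using vT by (simp add: power2_eq_square)
    also have "\<dots> \<le> \<theta> * (u T / v T) * M\<^sup>2"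
      using \<theta> uT vT by (intro mult_left_mono power_mono) auto
    also have "\<dots> = \<theta> * M\<^sup>2 * (u T / v T)" by simp
    also have "\<dots> \<le> \<theta> * M\<^sup>2 * (W T * (A + exp (k * T) / (k * (v b)\<^sup>2)))"
      using \<theta> gT by (intro mult_left_mono) auto
    also have "\<dots> \<le> W T * exp (k * T)" using 2 by (simp add: mult_ac)
    also have "\<dots> = v T * w T - u T * y T"
      by (simp add: W_def wronskian_def exp_minus)
    also have "\<dots> \<le> v T * w T" using uT ground_deriv_nonneg[OF v, of T] Tb by simp
    finally have "\<theta> * u T * v T \<le> w T * v T" by (simp add: mult_ac)
    then show ?thesis using vT by simp
  qed
  moreover have "T0 > 0" using b by (simp add: T0_def)
  ultimately show ?thesis by blast
qed

end

section \<open>Slopes with a sign change and the three zeros\<close>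

context supercritical_emden
begin

text \<open>At a late time \<open>T\<close> a small slope gives \<open>w / u \<ge> \<theta>\<close>
  by comparison with \<open>v\<close>, but \<open>ground_log_derivative\<close> would limit
  \<open>w / u\<close> to a smaller number if the solution stayed positive.\<close>

lemma small_slope_not_ground:
  assumes v: "ground s' v y" and bd: "\<And>t. t > 0 \<Longrightarrow> v t \<le> D"
  shows "\<exists>s u w T. 0 < s \<and> s < s' \<and> sol s u w \<and> T > 0 \<and> u T \<le> 0"
proof -
  \<comment> \<open>Half the gap between \<open>m * (k - m)\<close> and
    \<open>(k - m)\<^sup>2\<close>, positive by supercriticality. Thus \<open>q\<^sup>2\<close> is
    their midpoint, so \<open>m + q\<close> lies below \<open>k\<close> and above the Pohozaev bound
    for late times.\<close>
  define \<delta> where "\<delta> = (k - m) * (k - 2 * m) / 2"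
  have km: "k - m > 0" "k - 2 * m > 0" using m_super m_pos by auto
  then have \<delta>: "\<delta> > 0" by (simp add: \<delta>_def)
  define q where "q = sqrt (k * (k - m) / 2)"
  define \<theta> where "\<theta> = m + q"
  have sq: "q > 0" "q\<^sup>2 = m * (k - m) + \<delta>"
    using k km by (auto simp: q_def \<delta>_def field_simps)
  have "\<theta> < k"
  proof -
    have "(q)\<^sup>2 < (k - m)\<^sup>2"
      unfolding sq(2) \<delta>_def using mult_pos_pos[OF km] by (simp add: power2_eq_square field_simps)
    then have "q < k - m" by (rule power2_less_imp_less) (use km in simp)
    then show ?thesis by (simp add: \<theta>_def)
  qed
  moreover have "\<theta> > 0" using sq m_pos by (simp add: \<theta>_def)
  ultimately obtain T0 where T0: "T0 > 0" "\<And>T s u w. T \<ge> T0 \<Longrightarrow> sol s u w \<Longrightarrow>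
      (\<And>t. 0 < t \<Longrightarrow> t \<le> T \<Longrightarrow> 0 < u t \<and> u t \<le> v t / 2) \<Longrightarrow> \<theta> * u T \<le> w T"
    using half_ground_log_derivative[OF v bd, of \<theta>] by metis
  have "((\<lambda>T. B * lam * exp (- T)) \<longlongrightarrow> B * lam * 0) at_top"
    by (intro tendsto_mult tendsto_const filterlim_compose[OF exp_at_bot] filterlim_uminus_at_bot_at_top)
  then have "\<forall>\<^sub>F T in at_top. B * lam * exp (- T) < min \<delta> ((k - 2 * m) / 2)"
    using \<delta> km by (intro order_tendstoD(2)) auto
  then obtain T1 where T1: "\<And>T. T \<ge> T1 \<Longrightarrow> B * lam * exp (- T) < min \<delta> ((k - 2 * m) / 2)"
    by (auto simp: eventually_at_top_linorder)
  define T where "T = max T0 \<bar>T1\<bar>"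
  have T: "T \<ge> T0" "T > 0" "2 * T \<ge> T1" using T0 by (auto simp: T_def)
  have small: "B * lam * exp (- 2 * T) < \<delta>" "B * lam * exp (- 2 * T) \<le> (k - 2 * m) / 2"
    using T1[of "2 * T"] T by auto
  \<comment> \<open>The slope is chosen after \<open>T\<close>, which is possible because
    \<open>T0\<close> does not depend on the solution.\<close>
  obtain s where s: "0 < s" "s < s'"
    and half: "\<And>u w t. sol s u w \<Longrightarrow> 0 < t \<Longrightarrow> t \<le> T \<Longrightarrow> 0 < u t \<and> u t \<le> v t / 2"
    using small_slope_half_ground[OF v T(2)] by (metis order_refl)
  obtain u w where u: "sol s u w" using sol_exists[of s] s by auto
  have "\<not> ground s u w"
  proof
    assume g: "ground s u w"
    have uT: "u T > 0" using half[OF u, of T] T by simp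
    have "\<theta> * u T \<le> w T" using T0(2)[OF T(1) u half[OF u]] by simp
    then have "q * u T \<le> w T - m * u T"
      by (simp add: \<theta>_def algebra_simps)
    then have "(q * u T)\<^sup>2 \<le> (w T - m * u T)\<^sup>2"
      using sq uT by (intro power_mono) auto
    also have "\<dots> \<le> (m * (k - m) + B * lam * exp (- 2 * T)) * (u T)\<^sup>2"
      by (rule ground_log_derivative[OF g T(2) small(2)])
    also have "\<dots> < (m * (k - m) + \<delta>) * (u T)\<^sup>2"
      using small uT by (intro mult_strict_right_mono) auto
    finally show False by (simp add: power_mult_distrib sq(2))
  qed
  then obtain t where "t > 0" "u t \<le> 0"
    unfolding ground_def using u s by fastforce
  with s u show ?thesis by blast
qed

lemma large_slope_not_ground: "\<exists>s u w T. s' < s \<and> 0 < s \<and> sol s u w \<and> T > 0 \<and> u T \<le> 0"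
proof -
  obtain S where S: "\<And>s u w. ground s u w \<Longrightarrow> s \<le> S" using ground_slope_bounded by blast
  define s where "s = max (\<bar>S\<bar>) (\<bar>s'\<bar>) + 1"
  have s: "s > 0" "s > s'" "s > S" by (auto simp: s_def)
  obtain u w where u: "sol s u w" using sol_exists[of s] s by auto
  then have "\<not> ground s u w" using S[of s u w] s by auto
  then obtain t where "t > 0" "u t \<le> 0"
    unfolding ground_def using u s by fastforce
  with s u show ?thesis by blast
qed

text \<open>At time \<open>T\<close> the solutions of slopes
  \<open>r < \<sigma> < s' < \<tau>\<close> have signs plus, minus, plus, minus. The slopes
  \<open>\<sigma>\<close> and \<open>\<tau>\<close> are fixed beforehand, since a solution that has
  reached zero stays negative; only \<open>r\<close> depends on \<open>T\<close>.\<close>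

theorem three_zeros:
  assumes v: "ground s' v y" and bd: "\<And>t. t > 0 \<Longrightarrow> v t \<le> D"
  shows "\<exists>T0>0. \<forall>T>T0. \<exists>s1 s2 s3. 0 < s1 \<and> s1 < s2 \<and> s2 < s3 \<and>
           (\<forall>s\<in>{s1, s2, s3}. \<exists>u w. sol s u w \<and> u T = 0 \<and> (\<forall>t\<in>{0<..<T}. 0 < u t))"
proof -
  obtain \<sigma> u w T1 where u: "0 < \<sigma>" "\<sigma> < s'" "sol \<sigma> u w" "T1 > 0" "u T1 \<le> 0"
    using small_slope_not_ground[OF v bd] by blast
  obtain \<tau> x z T2 where x: "s' < \<tau>" "sol \<tau> x z" "T2 > 0" "x T2 \<le> 0" "0 < \<tau>"
    using large_slope_not_ground by blast
  have "\<exists>s1 s2 s3. 0 < s1 \<and> s1 < s2 \<and> s2 < s3 \<and>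
           (\<forall>s\<in>{s1, s2, s3}. \<exists>u w. sol s u w \<and> u T = 0 \<and> (\<forall>t\<in>{0<..<T}. 0 < u t))"
    if T: "T > max T1 T2" for T
  proof -
    have T0: "T > 0" using T u by simp
    have uT: "u T < 0" using T by (intro ode_sol_negative_after_zero[OF u(3) rhs_nonneg u(1,4,5)]) auto
    have xT: "x T < 0" using T by (intro ode_sol_negative_after_zero[OF x(2) rhs_nonneg x(5,3,4)]) auto
    have vT: "v T > 0" using groundD(3)[OF v T0] .
    obtain s0 where s0: "s0 > 0"
      "\<And>s u w t. 0 < s \<Longrightarrow> s \<le> s0 \<Longrightarrow> sol s u w \<Longrightarrow> 0 < t \<Longrightarrow> t \<le> T \<Longrightarrow> 0 < u t"
      using small_slope_half_ground[OF v T0] by metis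
    define r where "r = min s0 (\<sigma> / 2)"
    have r: "0 < r" "r \<le> s0" "r < \<sigma>" using s0 u by (auto simp: r_def)
    obtain q qw where q: "sol r q qw" using sol_exists[of r] r by auto
    have qT: "q T > 0" using s0(2)[OF r(1,2) q T0] by simp
    obtain s1 u1 w1 where 1: "r < s1" "s1 < \<sigma>" "sol s1 u1 w1" "u1 T = 0"
      using sol_intermediate_zero[OF _ _ r(3) q u(3), of T] qT uT T0 r(1) by (auto simp: mult_less_0_iff)
    obtain s2 u2 w2 where 2: "\<sigma> < s2" "s2 < s'" "sol s2 u2 w2" "u2 T = 0"
      using sol_intermediate_zero[OF _ _ u(2) u(3) groundD(1)[OF v], of T] vT uT T0 u(1) by (auto simp: mult_less_0_iff)
    obtain s3 u3 w3 where 3: "s' < s3" "s3 < \<tau>" "sol s3 u3 w3" "u3 T = 0"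
      using sol_intermediate_zero[OF _ _ x(1) groundD(1)[OF v] x(2), of T] vT xT T0 groundD(2)[OF v] by (auto simp: mult_less_0_iff)
    have pos: "\<forall>t\<in>{0<..<T}. 0 < f t" if "sol s f g" "f T = 0" "s > 0" for s f g
      using ode_sol_negative_after_zero[OF that(1) rhs_nonneg that(3), of _ T] that(2) by force
    have s: "0 < s1" "0 < s2" "0 < s3" "s1 < s2" "s2 < s3" using 1 2 3 r by auto
    show ?thesis
      using s 1 2 3 pos[OF 1(3,4) s(1)] pos[OF 2(3,4) s(2)] pos[OF 3(3,4) s(3)]
      by (intro exI[of _ s1] exI[of _ s2] exI[of _ s3]) blast
  qed
  then show ?thesis using u(4) by (intro exI[of _ "max T1 T2"]) auto
qed

end

text \<open>The substitution \<open>r = b * exp (- t)\<close> turns the radial equation into \<open>ode_sol\<close>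
  with \<open>k = N - 2\<close> and \<open>B = b\<^sup>2\<close>.\<close>

lemma ball_solution_imp_ground:
  fixes N :: nat
  assumes e: "emden (real N - 2) (b\<^sup>2) lam p" and b: "b > 0" and u: "positive_ball_solution N lam p b u"
  shows "\<exists>s v y D. emden.ground (real N - 2) (b\<^sup>2) lam p s v y \<and> (\<forall>t>0. v t \<le> D)"
proof -
  interpret emden "real N - 2" "b\<^sup>2" lam p by (rule e)
  obtain v w where
    du: "\<And>r. r \<in> {0..b} \<Longrightarrow> (u has_real_derivative v r) (at r within {0..b})" and
    cv: "continuous_on {0..b} v" and
    dv: "\<And>r. r \<in> {0<..<b} \<Longrightarrow> (v has_real_derivative w r) (at r)" and
    eq: "\<And>r. r \<in> {0<..<b} \<Longrightarrow> w r + (real N - 1) / r * v r + lam * u r + u r powr p = 0" and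
    ub: "u b = 0" and pos: "\<And>r. r \<in> {0..<b} \<Longrightarrow> u r > 0"
    using u unfolding positive_ball_solution_def ball_solution_def by blast
  define r where "r \<equiv> \<lambda>t. b * exp (- t)"
  have r: "r t > 0" "t \<ge> 0 \<Longrightarrow> r t \<le> b" "t > 0 \<Longrightarrow> r t < b" for t
    using b by (auto simp: r_def)
  have dr: "(r has_real_derivative - r t) (at t within S)" for t S
    unfolding r_def by (auto intro!: derivative_eq_intros)
  define U W where "U \<equiv> \<lambda>t. u (r t)" and "W \<equiv> \<lambda>t. - r t * v (r t)"
  have Upos: "U t > 0" if "t > 0" for t
    using pos[of "r t"] r[of t] that by (simp add: U_def)
  have sol: "sol (W 0) U W"
    unfolding ode_sol_def
  proof (intro conjI allI impI)
    fix t :: real assume t: "t \<ge> 0"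
    have "(u has_real_derivative v (r t)) (at (r t) within {0..b})"
      using du[of "r t"] r[of t] t by simp
    then have "(u has_real_derivative v (r t)) (at (r t) within r ` {0..})"
      by (rule DERIV_subset) (auto simp: less_imp_le r)
    from DERIV_image_chain[OF this dr]
    show "(U has_real_derivative W t) (at t within {0..})"
      by (simp add: U_def W_def o_def mult_ac)
  next
    have "continuous_on {0..} r" unfolding r_def by (intro continuous_intros)
    moreover from this have "continuous_on {0..} (\<lambda>t. v (r t))"
      by (intro continuous_on_compose2[OF cv]) (auto simp: less_imp_le r)
    ultimately show "continuous_on {0..} W"
      unfolding W_def by (intro continuous_intros)
  next
    fix t :: real assume t: "t > 0"
    have rt: "r t \<in> {0<..<b}" using r[of t] t by simp
    have "((\<lambda>t. v (r t)) has_real_derivative w (r t) * - r t) (at t)"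
      using DERIV_chain2[OF dv[OF rt] dr] .
    then have "(W has_real_derivative r t * v (r t) + (r t)\<^sup>2 * w (r t)) (at t)"
      unfolding W_def by (auto intro!: derivative_eq_intros dr simp: power2_eq_square)
    moreover have "r t * v (r t) + (r t)\<^sup>2 * w (r t) = (real N - 2) * W t - rhs t (U t)"
    proof -
      have "w (r t) = - ((real N - 1) / r t * v (r t)) - (lam * U t + U t powr p)"
        using eq[OF rt] unfolding U_def by linarith
      then have "r t * w (r t) = - (real N - 1) * v (r t) - r t * (lam * U t + U t powr p)"
        using rt by (simp add: field_simps)
      then have "r t * (r t * w (r t)) = r t * (- (real N - 1) * v (r t) - r t * (lam * U t + U t powr p))"
        by (rule arg_cong)
      then have "r t * v (r t) + (r t)\<^sup>2 * w (r t) =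
          (real N - 2) * (- r t * v (r t)) - (r t)\<^sup>2 * (lam * U t + U t powr p)"
        by (simp add: power2_eq_square algebra_simps)
      moreover have "(r t)\<^sup>2 = b\<^sup>2 * exp (- 2 * t)"
        by (simp add: r_def power_mult_distrib exp_double[symmetric])
      ultimately show ?thesis
        unfolding rhs_pos_eq[OF Upos[OF t]] W_def by simp
    qed
    ultimately show "(W has_real_derivative (real N - 2) * W t - rhs t (U t)) (at t)" by simp
  next
    show "U 0 = 0" using ub by (simp add: U_def r_def)
  qed simp
  \<comment> \<open>Regularity at the center of the ball enters here: continuity up to
    \<open>r = 0\<close> yields a bound for all \<open>t > 0\<close>.\<close>
  have "continuous_on {0..b} u" using du by (intro DERIV_continuous_on) auto
  then have "bounded (u ` {0..b})" by (intro compact_imp_bounded compact_continuous_image) auto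
  then obtain D where D: "\<And>x. x \<in> {0..b} \<Longrightarrow> \<bar>u x\<bar> \<le> D" unfolding bounded_real by blast
  have "U t \<le> D" if "t > 0" for t
    using D[of "r t"] r[of t] that by (auto simp: U_def)
  moreover have "ground (W 0) U W"
    unfolding ground_def using sol Upos ode_sol_slope_pos[OF sol rhs_nonneg, of 1] by auto
  ultimately show ?thesis by blast
qed

text \<open>The inverse substitution is \<open>t = ln (b / r)\<close>. Positivity identifies
  \<open>rhs\<close> with the actual nonlinearity.\<close>

lemma sol_imp_annulus_solution:
  fixes N :: nat
  assumes e: "emden (real N - 2) (b\<^sup>2) lam p" and ab: "0 < a" "a < b"
    and sol: "ode_sol (real N - 2) (emden.rhs (b\<^sup>2) lam p) s u w"
    and zero: "u (ln (b / a)) = 0" and pos: "\<forall>t\<in>{0<..<ln (b / a)}. 0 < u t"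
  shows "positive_annulus_solution N lam p a b (\<lambda>r. u (ln (b / r)))"
proof -
  interpret emden "real N - 2" "b\<^sup>2" lam p by (rule e)
  define \<tau> where "\<tau> \<equiv> \<lambda>r. ln (b / r)"
  have \<tau>: "r \<le> b \<Longrightarrow> \<tau> r \<ge> 0" "r < b \<Longrightarrow> \<tau> r > 0" "a < r \<Longrightarrow> \<tau> r < \<tau> a" if "r > 0" for r
    using that ab by (auto simp: \<tau>_def divide_simps)
  have d\<tau>: "(\<tau> has_real_derivative - 1 / r) (at r within S)" if "r > 0" for r S
    unfolding \<tau>_def using that ab by (auto intro!: derivative_eq_intros simp: field_simps)
  have upos: "u (\<tau> r) > 0" if "r \<in> {a<..<b}" for r
    using pos \<tau>[of r] that ab by (auto simp: \<tau>_def)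
  define V where "V \<equiv> \<lambda>r. - w (\<tau> r) / r"
  \<comment> \<open>This is the radial equation solved for the second derivative; the content is the
    later proof that \<open>Z\<close> is the derivative of \<open>V\<close>.\<close>
  define Z where "Z \<equiv> \<lambda>r. ((real N - 1) * w (\<tau> r)) / r\<^sup>2 - (lam * u (\<tau> r) + u (\<tau> r) powr p)"
  have 1: "((\<lambda>r. u (\<tau> r)) has_real_derivative V r) (at r within {a..b})" if r: "r \<in> {a..b}" for r
  proof -
    have "(u has_real_derivative w (\<tau> r)) (at (\<tau> r) within {0..})"
      using sol \<tau>[of r] r ab by (auto simp: ode_sol_def)
    then have "(u has_real_derivative w (\<tau> r)) (at (\<tau> r) within \<tau> ` {a..b})"
      using \<tau> ab by (elim DERIV_subset) auto
    from DERIV_image_chain[OF this d\<tau>[of r]] show ?thesis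
      using r ab by (simp add: V_def o_def)
  qed
  have 2: "continuous_on {a..b} V"
  proof -
    have "continuous_on {0..} w" using sol unfolding ode_sol_def by blast
    moreover have "continuous_on {a..b} \<tau>" unfolding \<tau>_def using ab by (intro continuous_intros) auto
    ultimately have "continuous_on {a..b} (\<lambda>r. w (\<tau> r))"
      by (rule continuous_on_compose2) (use \<tau> ab in auto)
    then show ?thesis unfolding V_def using ab by (intro continuous_intros) auto
  qed
  have 3: "(V has_real_derivative Z r) (at r)" if r: "r \<in> {a<..<b}" for r
  proof -
    have r0: "r > 0" "\<tau> r > 0" using r ab \<tau>[of r] by auto
    have "((\<lambda>r. w (\<tau> r)) has_real_derivative ((real N - 2) * w (\<tau> r) - rhs (\<tau> r) (u (\<tau> r))) * (- 1 / r)) (at r)"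
      using DERIV_chain2[OF ode_solD(2)[OF sol r0(2)] d\<tau>[OF r0(1)]] .
    then have "(V has_real_derivative ((real N - 2) * w (\<tau> r) - rhs (\<tau> r) (u (\<tau> r)) + w (\<tau> r)) / r\<^sup>2) (at r)"
      unfolding V_def using r0 by (auto intro!: derivative_eq_intros simp: field_simps power2_eq_square)
    moreover have "rhs (\<tau> r) (u (\<tau> r)) = r\<^sup>2 * (lam * u (\<tau> r) + u (\<tau> r) powr p)"
    proof -
      have "exp (\<tau> r) = b / r" using r0 ab by (simp add: \<tau>_def)
      then have "b\<^sup>2 * exp (- 2 * \<tau> r) = r\<^sup>2"
        using exp_double[of "\<tau> r"] r0 ab by (simp add: exp_minus power_divide)
      then show ?thesis unfolding rhs_pos_eq[OF upos[OF r]] by simp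
    qed
    ultimately show ?thesis using r0 by (simp add: Z_def field_simps)
  qed
  have 4: "Z r + (real N - 1) / r * V r + lam * u (\<tau> r) + u (\<tau> r) powr p = 0" for r
    by (simp add: Z_def V_def power2_eq_square)
  have "annulus_solution N lam p a b (\<lambda>r. u (\<tau> r))"
    unfolding annulus_solution_def
  proof (rule exI[of _ V], rule exI[of _ Z], intro conjI ballI)
    show "u (\<tau> a) = 0" "u (\<tau> b) = 0"
      using zero ode_solD(5)[OF sol] ab by (auto simp: \<tau>_def)
  qed (use 1 2 3 4 in auto)
  then show ?thesis
    unfolding positive_annulus_solution_def using upos by (auto simp: \<tau>_def)
qed

theorem theorem1p4:
  fixes N :: nat and p b lam :: real
  assumes "N \<ge> 3" and "p > (real N + 2) / (real N - 2)" and "b > 0" and "lam > 0"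
    and "\<exists>u. positive_ball_solution N lam p b u"
  shows "\<exists>a0\<in>{0<..<b}. \<forall>a\<in>{0<..<a0}.
           \<exists>u1 u2 u3. positive_annulus_solution N lam p a b u1
                    \<and> positive_annulus_solution N lam p a b u2
                    \<and> positive_annulus_solution N lam p a b u3
                    \<and> (\<exists>r\<in>{a..b}. u1 r \<noteq> u2 r)
                    \<and> (\<exists>r\<in>{a..b}. u1 r \<noteq> u3 r)
                    \<and> (\<exists>r\<in>{a..b}. u2 r \<noteq> u3 r)"
proof -
  have k: "real N - 2 > 0" using assms(1) by simp
  have p': "p - 1 > 4 / (real N - 2)" using assms(2) k by (simp add: field_simps)
  then have p: "p > 1" using k by (smt (verit) divide_pos_pos)
  interpret supercritical_emden "real N - 2" "b\<^sup>2" lam p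
    by unfold_locales (use k p p' assms in \<open>auto simp: field_simps\<close>)
  obtain s v y D where v: "ground s v y" "\<And>t. t > 0 \<Longrightarrow> v t \<le> D"
    using ball_solution_imp_ground[OF emden_axioms assms(3)] assms(5) by blast
  obtain T0 where T0: "T0 > 0" "\<And>T. T > T0 \<Longrightarrow> \<exists>s1 s2 s3. 0 < s1 \<and> s1 < s2 \<and> s2 < s3 \<and>
           (\<forall>s\<in>{s1, s2, s3}. \<exists>u w. sol s u w \<and> u T = 0 \<and> (\<forall>t\<in>{0<..<T}. 0 < u t))"
    using three_zeros[OF v] by blast
  show ?thesis
  \<comment> \<open>With this choice, \<open>a < a0\<close> means exactly
    \<open>ln (b / a) > T0\<close>.\<close>
  proof (intro bexI[of _ "b * exp (- T0)"] ballI)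
    show "b * exp (- T0) \<in> {0<..<b}" using T0 assms by auto
    fix a assume a: "a \<in> {0<..<b * exp (- T0)}"
    then have ab: "0 < a" "a < b"
      using T0 assms(3) by (auto elim: order_less_trans)
    define T where "T = ln (b / a)"
    have "exp T0 < b / a" using a ab by (simp add: exp_minus field_simps)
    then have "ln (exp T0) < ln (b / a)" using ab by (subst ln_less_cancel_iff) auto
    then have T: "T > T0" by (simp add: T_def)
    obtain s1 s2 s3 where s: "0 < s1" "s1 < s2" "s2 < s3"
      and ex: "\<And>s. s \<in> {s1, s2, s3} \<Longrightarrow> \<exists>u w. sol s u w \<and> u T = 0 \<and> (\<forall>t\<in>{0<..<T}. 0 < u t)"
      using T0(2)[OF T] by blast
    obtain u1 w1 where u1: "sol s1 u1 w1" "u1 T = 0" "\<forall>t\<in>{0<..<T}. 0 < u1 t" using ex[of s1] by blast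
    obtain u2 w2 where u2: "sol s2 u2 w2" "u2 T = 0" "\<forall>t\<in>{0<..<T}. 0 < u2 t" using ex[of s2] by blast
    obtain u3 w3 where u3: "sol s3 u3 w3" "u3 T = 0" "\<forall>t\<in>{0<..<T}. 0 < u3 t" using ex[of s3] by blast
    \<comment> \<open>Agreement on the annulus would mean agreement on \<open>(0, T)\<close>, hence
      equal slopes at \<open>t = 0\<close>.\<close>
    have neq: "\<exists>r\<in>{a..b}. f (ln (b / r)) \<noteq> g (ln (b / r))"
      if f: "sol s f x" and g: "sol s' g z" and "s \<noteq> s'" for s s' f g x z
    proof (rule ccontr)
      assume "\<not> ?thesis"
      then have eq: "f (ln (b / r)) = g (ln (b / r))" if "r \<in> {a..b}" for r using that by blast
      have "f t = g t" if t: "0 < t" "t < T" for t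
      proof -
        have "a = b * exp (- T)" using ab by (simp add: T_def exp_minus)
        then have "b * exp (- t) \<in> {a..b}" using t ab by auto
        moreover have "b / (b * exp (- t)) = exp t" using ab by (simp add: exp_minus field_simps)
        ultimately show ?thesis using eq[of "b * exp (- t)"] by simp
      qed
      then show False using ode_sol_slope_unique[OF f g, of T] that(3) T T0 by auto
    qed
    have ann: "positive_annulus_solution N lam p a b (\<lambda>r. f (ln (b / r)))"
      if "sol s f x" "f T = 0" "\<forall>t\<in>{0<..<T}. 0 < f t" for s f x
      using sol_imp_annulus_solution[OF emden_axioms ab] that unfolding T_def by blast
    show "\<exists>u1 u2 u3. positive_annulus_solution N lam p a b u1
                    \<and> positive_annulus_solution N lam p a b u2
                    \<and> positive_annulus_solution N lam p a b u3
                    \<and> (\<exists>r\<in>{a..b}. u1 r \<noteq> u2 r)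
                    \<and> (\<exists>r\<in>{a..b}. u1 r \<noteq> u3 r)
                    \<and> (\<exists>r\<in>{a..b}. u2 r \<noteq> u3 r)"
      using ann[OF u1] ann[OF u2] ann[OF u3] neq[OF u1(1) u2(1)] neq[OF u1(1) u3(1)] neq[OF u2(1) u3(1)] s
      by (intro exI[of _ "\<lambda>r. u1 (ln (b / r))"] exI[of _ "\<lambda>r. u2 (ln (b / r))"] exI[of _ "\<lambda>r. u3 (ln (b / r))"]) auto
  qed
qed

end
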